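(* Let $x\in\mathbb{R}^n$, $X=xx^\top$, let $a_1,\dots,a_m\in\mathbb{R}^n$ be random vectors whose entries are i.i.d. standard Gaussian, and let $A_j=a_ja_j^\top$. Let $\mathcal{M}_1$ be the manifold of real symmetric $n\times n$ matrices of rank $1$, and define $$f:\mathcal{M}_1\to\mathbb{R},\qquad f(Z)=\frac{1}{2m}\sum_{j=1}^m|\langle A_j,Z-X\rangle|^2 .$$ If $m\ge n$, then almost surely $f$ has only finitely many critical points on the manifold $\mathcal{M}_1$.
   Context: $\langle A,B\rangle=\mathrm{trace}(A^\top B)$ is the Frobenius inner product, and $\mathcal{M}_1$ carries the Riemannian metric inherited from it. A critical point of $f$ on $\mathcal{M}_1$ is a point $Z\in\mathcal{M}_1$ with vanishing Riemannian gradient, i.e. $P_{T_Z}(\nabla f(Z))=\frac1m\sum_{j=1}^m\langle A_j,Z-X\rangle P_{T_Z}(A_j)=0$. If $u$ is a unit vector spanning the column space of $Z$, the tangent space is $T_Z=\{w\,uu^\top+uv^\top+vu^\top: w\in\mathbb{R},\ v\in\mathbb{R}^n,\ v\perp u\}$ and $P_{T_Z}$ is the orthogonal projection onto it. *)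

theory Defs
  imports "HOL-Probability.Probability"
begin

definition outer :: "real^'n \<Rightarrow> real^'n \<Rightarrow> real^'n^'n" where
  "outer u v = (\<chi> i j. u $ i * v $ j)"

definition frob :: "real^'n^'n \<Rightarrow> real^'n^'n \<Rightarrow> real" where
  "frob A B = trace (transpose A ** B)"

definition M1 :: "(real^'n^'n) set" where
  "M1 = {Z. transpose Z = Z \<and> rank Z = 1}"

(* The unit vector u spanning the column space of Z is unique up to sign, and u and -u
   give the same tangent space; see tangent_space_unit below. *)
definition tangent_space :: "real^'n^'n \<Rightarrow> (real^'n^'n) set" where
  "tangent_space Z =
     {w *\<^sub>R outer u u + outer u v + outer v u | w u v.
        norm u = 1 \<and> span {u} = span (columns Z) \<and> v \<bullet> u = 0}"

definition orth_proj :: "(real^'n^'n) set \<Rightarrow> real^'n^'n \<Rightarrow> real^'n^'n" where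
  "orth_proj T Y = (THE P. P \<in> T \<and> (\<forall>S\<in>T. frob (Y - P) S = 0))"

definition euclidean_gradient :: "(real^'n^'n \<Rightarrow> real) \<Rightarrow> real^'n^'n \<Rightarrow> real^'n^'n" where
  "euclidean_gradient g Z = (THE G. (g has_derivative (\<lambda>H. frob G H)) (at Z))"

(* M1 carries the metric inherited from the Frobenius inner product, so the Riemannian
   gradient on M1 is the tangential part of the gradient in the ambient matrix space. *)
definition riemannian_gradient :: "(real^'n^'n \<Rightarrow> real) \<Rightarrow> real^'n^'n \<Rightarrow> real^'n^'n" where
  "riemannian_gradient g Z = orth_proj (tangent_space Z) (euclidean_gradient g Z)"

definition critical_points :: "(real^'n^'n \<Rightarrow> real) \<Rightarrow> (real^'n^'n) set" where
  "critical_points g = {Z \<in> M1. riemannian_gradient g Z = 0}"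

(* The defining formula of f makes sense on all matrices; only points of M1 can be
   members of critical_points. *)
definition objective :: "nat \<Rightarrow> (nat \<Rightarrow> real^'n) \<Rightarrow> real^'n \<Rightarrow> real^'n^'n \<Rightarrow> real" where
  "objective m a x Z =
     1 / (2 * real m) * (\<Sum>j=1..m. \<bar>frob (outer (a j) (a j)) (Z - outer x x)\<bar>\<^sup>2)"

definition (in prob_space) iid_std_gaussian_entries ::
    "nat \<Rightarrow> (nat \<Rightarrow> 'a \<Rightarrow> real^'n) \<Rightarrow> bool" where
  "iid_std_gaussian_entries m a \<longleftrightarrow>
     indep_vars (\<lambda>_. borel) (\<lambda>(j, i) \<omega>. a j \<omega> $ i) ({1..m} \<times> UNIV) \<and>
     (\<forall>j\<in>{1..m}. \<forall>i. distributed M lborel (\<lambda>\<omega>. a j \<omega> $ i) std_normal_density)"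

lemma frob_eq_inner: "frob A B = A \<bullet> B"
  unfolding frob_def trace_def matrix_matrix_mult_def transpose_def inner_vec_def
  by (simp, rule sum.swap)

lemma outer_minus: "outer (- u) v = - outer u v" "outer u (- v) = - outer u v"
  by (simp_all add: outer_def vec_eq_iff)

lemma outer_zero: "outer 0 v = 0" "outer u 0 = 0"
  by (simp_all add: outer_def vec_eq_iff)

lemma outer_add: "outer (u + v) w = outer u w + outer v w" "outer w (u + v) = outer w u + outer w v"
  by (simp_all add: outer_def vec_eq_iff algebra_simps)

lemma outer_scaleR: "outer (c *\<^sub>R u) w = c *\<^sub>R outer u w" "outer w (c *\<^sub>R u) = c *\<^sub>R outer w u"
  by (simp_all add: outer_def vec_eq_iff algebra_simps)

lemma span_unit_eq:
  fixes u u' :: "real^'n"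
  assumes "norm u = 1" "norm u' = 1" "span {u'} = span {u}"
  shows "u' = u \<or> u' = - u"
proof -
  have "u' \<in> span {u}" using assms(3) by (metis insertI1 span_base)
  then obtain c where c: "u' = c *\<^sub>R u" by (auto simp: span_singleton)
  with assms have "\<bar>c\<bar> = 1" by simp
  then have "c = 1 \<or> c = -1" by linarith
  with c show ?thesis by auto
qed

lemma tangent_space_unit:
  assumes "norm u = 1" "span {u} = span (columns Z)"
  shows "tangent_space Z =
    {w *\<^sub>R outer u u + outer u v + outer v u | w v. v \<bullet> u = 0}" (is "_ = ?R")
proof
  show "?R \<subseteq> tangent_space Z"
    using assms unfolding tangent_space_def by blast
  show "tangent_space Z \<subseteq> ?R"
  proof
    fix S assume "S \<in> tangent_space Z"
    then obtain w u' v where S: "S = w *\<^sub>R outer u' u' + outer u' v + outer v u'"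
      and *: "norm u' = 1" "span {u'} = span (columns Z)" "v \<bullet> u' = 0"
      unfolding tangent_space_def by blast
    from span_unit_eq[of u u'] assms * have "u' = u \<or> u' = - u" by simp
    then show "S \<in> ?R"
    proof
      assume "u' = u" with S * show ?thesis by blast
    next
      assume "u' = - u"
      with S * have "S = w *\<^sub>R outer u u + outer u (- v) + outer (- v) u" "(- v) \<bullet> u = 0"
        by (simp_all add: outer_minus)
      then show ?thesis by blast
    qed
  qed
qed

lemma M1_unit_vector:
  fixes Z :: "real^'n^'n"
  assumes "Z \<in> M1"
  obtains u where "norm u = 1" "span {u} = span (columns Z)"
proof -
  have "dim (columns Z) = 1"
    using assms by (simp add: M1_def column_rank_def)
  then have d: "dim (span (columns Z)) = 1" by simp
  then obtain v where v: "v \<in> span (columns Z)" "v \<noteq> 0"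
    by (metis dim_eq_0 subsetI singletonI zero_neq_one)
  have "span {v} = span (columns Z)"
  proof (rule subspace_dim_equal)
    show "span {v} \<subseteq> span (columns Z)" using v by (simp add: span_minimal)
    have "dim {v} = 1" using v by (simp add: dim_singleton)
    then show "dim (span (columns Z)) \<le> dim (span {v})" using d by simp
  qed auto
  moreover have "span {(1 / norm v) *\<^sub>R v} = span {v}"
    using v by (intro span_eq[THEN iffD2])
      (auto simp: span_singleton intro!: image_eqI[of _ _ "norm v"])
  ultimately show ?thesis using v by (intro that[of "(1 / norm v) *\<^sub>R v"]) auto
qed

lemma subspace_tangent_space:
  assumes "Z \<in> M1"
  shows "subspace (tangent_space Z)"
proof -
  obtain u where u: "norm u = 1" "span {u} = span (columns Z)"
    using M1_unit_vector[OF assms] .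
  show ?thesis
    unfolding tangent_space_unit[OF u]
  proof (rule subspaceI, goal_cases)
    case 1
    show ?case by (rule CollectI, rule exI[of _ 0], rule exI[of _ 0]) (simp add: outer_zero)
  next
    case (2 S S')
    then obtain w v w' v' where *: "S = w *\<^sub>R outer u u + outer u v + outer v u" "v \<bullet> u = 0"
      "S' = w' *\<^sub>R outer u u + outer u v' + outer v' u" "v' \<bullet> u = 0" by blast
    show ?case
      by (rule CollectI, rule exI[of _ "w + w'"], rule exI[of _ "v + v'"])
        (simp add: * outer_add algebra_simps)
  next
    case (3 c S)
    then obtain w v where *: "S = w *\<^sub>R outer u u + outer u v + outer v u" "v \<bullet> u = 0" by blast
    show ?case
      by (rule CollectI, rule exI[of _ "c * w"], rule exI[of _ "c *\<^sub>R v"])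
        (simp add: * outer_scaleR algebra_simps)
  qed
qed

lemma orth_proj_eqI:
  assumes "subspace T" "P \<in> T" "\<And>S. S \<in> T \<Longrightarrow> frob (Y - P) S = 0"
  shows "orth_proj T Y = P"
  unfolding orth_proj_def
proof (rule the_equality)
  fix Q assume Q: "Q \<in> T \<and> (\<forall>S\<in>T. frob (Y - Q) S = 0)"
  have "Q - P \<in> T" using assms Q by (simp add: subspace_diff)
  then have "(Y - P) \<bullet> (Q - P) = 0" "(Y - Q) \<bullet> (Q - P) = 0"
    using assms(3) Q by (auto simp: frob_eq_inner)
  then have "(Q - P) \<bullet> (Q - P) = 0" by (simp add: algebra_simps)
  then show "Q = P" by simp
qed (use assms in auto)

lemma orth_proj_props:
  assumes "subspace T"
  shows "orth_proj T Y \<in> T" "S \<in> T \<Longrightarrow> frob (Y - orth_proj T Y) S = 0"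
proof -
  obtain P R where *: "P \<in> span T" "\<And>S. S \<in> span T \<Longrightarrow> orthogonal R S" "Y = P + R"
    using orthogonal_subspace_decomp_exists[of T Y] by metis
  have T: "span T = T" using assms by (simp only: span_eq_iff)
  note * = *[unfolded T]
  have "orth_proj T Y = P"
    using assms * by (intro orth_proj_eqI) (auto simp: frob_eq_inner orthogonal_def)
  then show "orth_proj T Y \<in> T" "S \<in> T \<Longrightarrow> frob (Y - orth_proj T Y) S = 0"
    using * by (auto simp: frob_eq_inner orthogonal_def)
qed

lemma euclidean_gradient_eqI:
  assumes "(g has_derivative (\<lambda>H. frob G H)) (at Z)"
  shows "euclidean_gradient g Z = G"
  unfolding euclidean_gradient_def
proof (rule the_equality)
  fix G' assume "(g has_derivative (\<lambda>H. frob G' H)) (at Z)"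
  then have "(\<lambda>H. frob G' H) = (\<lambda>H. frob G H)"
    using assms has_derivative_unique by blast
  then have "\<And>H. G' \<bullet> H = G \<bullet> H" by (metis frob_eq_inner)
  then show "G' = G" using vector_eq_rdot by blast
qed (rule assms)

lemma euclidean_gradient_objective:
  "euclidean_gradient (objective m a x) Z =
     (1 / real m) *\<^sub>R (\<Sum>j=1..m. frob (outer (a j) (a j)) (Z - outer x x) *\<^sub>R outer (a j) (a j))"
proof (rule euclidean_gradient_eqI)
  have "objective m a x =
      (\<lambda>Z. 1 / (2 * real m) * (\<Sum>j=1..m. (outer (a j) (a j) \<bullet> (Z - outer x x))\<^sup>2))"
    by (rule ext) (simp add: objective_def frob_eq_inner)
  moreover have "((\<lambda>Z. 1 / (2 * real m) * (\<Sum>j=1..m. (outer (a j) (a j) \<bullet> (Z - outer x x))\<^sup>2))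
      has_derivative (\<lambda>H. 1 / (2 * real m) *
        (\<Sum>j=1..m. 2 * (outer (a j) (a j) \<bullet> (Z - outer x x)) * (outer (a j) (a j) \<bullet> H)))) (at Z)"
    by (rule has_derivative_mult_right, rule has_derivative_sum)
      (auto intro!: derivative_eq_intros ext simp: algebra_simps)
  moreover have "(\<lambda>H. 1 / (2 * real m) *
        (\<Sum>j=1..m. 2 * (outer (a j) (a j) \<bullet> (Z - outer x x)) * (outer (a j) (a j) \<bullet> H))) =
      frob ((1 / real m) *\<^sub>R
        (\<Sum>j=1..m. frob (outer (a j) (a j)) (Z - outer x x) *\<^sub>R outer (a j) (a j)))"
    by (rule ext) (simp add: frob_eq_inner inner_sum_left mult.assoc flip: sum_distrib_left)
  ultimately show "(objective m a x has_derivative frob ((1 / real m) *\<^sub>R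
      (\<Sum>j=1..m. frob (outer (a j) (a j)) (Z - outer x x) *\<^sub>R outer (a j) (a j)))) (at Z)"
    by simp
qed

lemma riemannian_gradient_objective:
  assumes "Z \<in> M1"
  shows "riemannian_gradient (objective m a x) Z =
    (1 / real m) *\<^sub>R (\<Sum>j=1..m. frob (outer (a j) (a j)) (Z - outer x x) *\<^sub>R
       orth_proj (tangent_space Z) (outer (a j) (a j)))"
proof -
  note T = subspace_tangent_space[OF assms]
  show ?thesis
    unfolding riemannian_gradient_def euclidean_gradient_objective
  proof (rule orth_proj_eqI[OF T], goal_cases)
    case 1
    show ?case by (intro subspace_scale subspace_sum T orth_proj_props)
  next
    case (2 S)
    have "outer (a j) (a j) \<bullet> S = orth_proj (tangent_space Z) (outer (a j) (a j)) \<bullet> S" for j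
      using orth_proj_props(2)[OF T 2, of "outer (a j) (a j)"]
      by (simp add: frob_eq_inner inner_diff_left)
    then show ?case
      by (simp add: frob_eq_inner inner_diff_left inner_sum_left)
  qed
qed

end

(* A critical point on M1 has the form Z = z z^T: the sign -1 is impossible because the a_j span
   R^n. With t_j = a_j.z and s_j = a_j.x it satisfies F(z) = sum_j c_j a_j = 0 for
   c_j = t_j^3 - s_j^2 t_j. The zeros of F form a compact set, so it suffices that almost surely
   each of them is nondegenerate, hence isolated.

   Zeros with some c_j <> 0: fix the other vectors and put w = sum_{i <> j} c_i a_i. Then
   c_j a_j = -w, and since a_j |-> c_j a_j is homogeneous of degree 4, this can be solved for a_j
   explicitly, up to sign, as a function Psi of z alone. By Sard's theorem almost every a_j is a
   regular value of Psi, and a degenerate zero of F would be a critical point of Psi.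

   Zeros with all c_j = 0: here every t_j lies in {0, s_j, -s_j}, so n independent vectors a_j
   leave finitely many candidates. If m = n, all zeros are of this kind. If m > n, a further a_j
   almost surely excludes all candidates but 0, x and -x, where the derivative of F is definite. *)
theory Submission
  imports Defs
begin

section \<open>Sard's theorem in equal dimensions\<close>

text \<open>The library's \<open>baby_Sard\<close> needs a well-ordered index type; copying the index type
  removes that restriction.\<close>

datatype 'a ordered_copy = Ordered_Copy (original: 'a)

lemma bij_original: "bij original"
  by (rule bijI') (auto intro: ordered_copy.expand, metis ordered_copy.sel)

instance ordered_copy :: (finite) finite
  by standard (metis bij_original bij_betw_finite finite_code)

lemma CARD_ordered_copy: "CARD('a ordered_copy) = CARD('a)"
  using bij_original by (rule bij_betw_same_card)

text \<open>Any injection into the naturals serves: the order and its well-foundedness are pulled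
  back along it.\<close>

definition ordered_copy_index :: "'a::finite ordered_copy \<Rightarrow> nat" where
  "ordered_copy_index = (SOME f. inj f)"

lemma inj_ordered_copy_index: "inj ordered_copy_index"
  unfolding ordered_copy_index_def
  using finite_imp_inj_to_nat_seg[of "UNIV :: 'a ordered_copy set"]
  by (intro someI_ex[of inj]) auto

instantiation ordered_copy :: (finite) wellorder
begin

definition "x \<le> y \<longleftrightarrow> ordered_copy_index x \<le> ordered_copy_index y"
definition "x < y \<longleftrightarrow> ordered_copy_index x < ordered_copy_index y"

instance
proof
  fix P :: "'a ordered_copy \<Rightarrow> bool" and a
  assume *: "\<And>x. (\<And>y. y < x \<Longrightarrow> P y) \<Longrightarrow> P x"
  show "P a"
    by (induction a rule: measure_induct_rule[of ordered_copy_index]) 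
       (use * in \<open>simp add: less_ordered_copy_def\<close>)
qed (auto simp: less_eq_ordered_copy_def less_ordered_copy_def
      dest: inj_ordered_copy_index[THEN injD])

end

text \<open>Conjugating \<open>f\<close> with the relabelling of coordinates \<open>E\<close> and
  its inverse \<open>D\<close> reduces the claim to \<open>baby_Sard\<close>; a kernel vector of the
  derivative makes its rank drop. Singularity is phrased by a kernel vector because degenerate zeros
  supply one.\<close>

lemma Sard_equal_dim:
  fixes f :: "real^'n \<Rightarrow> real^'n"
  assumes der: "\<And>z. z \<in> S \<Longrightarrow> (f has_derivative f' z) (at z)"
    and sing: "\<And>z. z \<in> S \<Longrightarrow> \<exists>h. h \<noteq> 0 \<and> f' z h = 0"
  shows "negligible (f ` S)"
proof -
  define E :: "real^'n \<Rightarrow> real^'n ordered_copy" where "E v = (\<chi> i. v $ original i)" for v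
  define D :: "real^'n ordered_copy \<Rightarrow> real^'n" where "D v = (\<chi> i. v $ Ordered_Copy i)" for v
  have lin: "linear E" "linear D"
    by (auto intro!: linearI simp: E_def D_def vec_eq_iff)
  have DE: "D (E v) = v" for v by (simp add: E_def D_def vec_eq_iff)
  note bl = lin[THEN linear_linear[THEN iffD2]]
  have "negligible ((E \<circ> f \<circ> D) ` (E ` S))"
  proof (rule baby_Sard[where f' = "\<lambda>z. E \<circ> f' (D z) \<circ> D"])
    fix z assume "z \<in> E ` S"
    then have z: "D z \<in> S" using DE by auto
    have "(E \<circ> f \<circ> D has_derivative E \<circ> f' (D z) \<circ> D) (at z)"
      using der[OF z] bl
      by (auto intro!: diff_chain_at bounded_linear_imp_has_derivative)
    then show "(E \<circ> f \<circ> D has_derivative E \<circ> f' (D z) \<circ> D) (at z within E ` S)"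
      by (rule has_derivative_at_withinI)
    obtain h where h: "h \<noteq> 0" "f' (D z) h = 0" using sing[OF z] by auto
    have lf: "linear (f' (D z))" using der[OF z] by (rule has_derivative_linear)
    have l: "linear (E \<circ> f' (D z) \<circ> D)" using lin lf by (intro linear_compose)
    have "matrix (E \<circ> f' (D z) \<circ> D) *v E h = 0"
      using l h lin by (simp add: matrix_works DE linear_0)
    moreover have "E h \<noteq> 0" using h DE[of h] lin by (metis linear_0)
    ultimately show "rank (matrix (E \<circ> f' (D z) \<circ> D)) < CARD('n ordered_copy)"
      unfolding less_rank_noninjective by (metis injD matrix_vector_mult_0_right)
  qed simp
  moreover have "(E \<circ> f \<circ> D) ` (E ` S) = E ` f ` S" by (auto simp: DE image_iff)
  ultimately have neg: "negligible (E ` f ` S)" by simp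
  \<comment> \<open>\<open>D\<close> is linear between spaces of equal dimension, so it carries null
    sets back to null sets.\<close>
  have "negligible (D ` E ` f ` S)"
    by (rule negligible_differentiable_image_negligible[OF _ neg])
       (auto simp: CARD_ordered_copy intro!: linear_imp_differentiable_on lin)
  then show ?thesis by (simp add: image_image DE)
qed

section \<open>The critical point equation\<close>

text \<open>An injective \<open>f'\<close> satisfies \<open>B * norm h \<le> norm (f' h)\<close> for
  some positive \<open>B\<close>. Within the radius where the remainder is at most
  \<open>B / 2 * norm (y - z)\<close>, a second zero would contradict this.\<close>

lemma isolated_zero_if_derivative_injective:
  fixes f :: "'a::real_normed_vector \<Rightarrow> 'b::euclidean_space"
  assumes der: "(f has_derivative f') (at z)" and inj: "\<And>h. f' h = 0 \<Longrightarrow> h = 0" and "f z = 0"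
  shows "\<not> z islimpt {y. f y = 0}"
proof
  assume lim: "z islimpt {y. f y = 0}"
  have lin: "linear f'" using der by (rule has_derivative_linear)
  then obtain B where B: "B > 0" "\<And>h. B * norm h \<le> norm (f' h)"
    using linear_inj_bounded_below_pos[of f'] inj by (metis linear_injective_0)
  obtain d where d: "d > 0"
    "\<And>y. norm (y - z) < d \<Longrightarrow> norm (f y - f z - f' (y - z)) \<le> B / 2 * norm (y - z)"
    using der B(1) unfolding has_derivative_at_alt by (metis half_gt_zero)
  obtain y where y: "f y = 0" "y \<noteq> z" "dist y z < d"
    using lim d(1) unfolding islimpt_approachable by blast
  have "B * norm (y - z) \<le> B / 2 * norm (y - z)"
    using d(2)[of y] B(2)[of "y - z"] y \<open>f z = 0\<close> by (simp add: dist_norm)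
  then show False using B(1) y by simp
qed

definition cubic_coeff :: "real \<Rightarrow> real \<Rightarrow> real" where "cubic_coeff t s = t ^ 3 - s\<^sup>2 * t"

text \<open>For \<open>I = {1..m}\<close> this is m/2 times the gradient of z |-> f(z z^T), so
  \<open>cubic_map_deriv\<close> is the Hessian of that function up to the same factor.\<close>

definition cubic_map :: "'i set \<Rightarrow> ('i \<Rightarrow> 'a::euclidean_space) \<Rightarrow> 'a \<Rightarrow> 'a \<Rightarrow> 'a" where
  "cubic_map I a x z = (\<Sum>j\<in>I. cubic_coeff (a j \<bullet> z) (a j \<bullet> x) *\<^sub>R a j)"

definition cubic_map_deriv :: "'i set \<Rightarrow> ('i \<Rightarrow> 'a::euclidean_space) \<Rightarrow> 'a \<Rightarrow> 'a \<Rightarrow> 'a \<Rightarrow> 'a" where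
  "cubic_map_deriv I a x z h =
     (\<Sum>j\<in>I. ((3 * (a j \<bullet> z)\<^sup>2 - (a j \<bullet> x)\<^sup>2) * (a j \<bullet> h)) *\<^sub>R a j)"

lemma has_derivative_cubic_map:
  "(cubic_map I a x has_derivative cubic_map_deriv I a x z) (at z)"
  unfolding cubic_map_def[abs_def] cubic_map_deriv_def[abs_def] cubic_coeff_def
  by (rule has_derivative_sum, rule has_derivative_scaleR_left)
     (auto intro!: derivative_eq_intros simp: fun_eq_iff algebra_simps)

lemma cubic_coeff_eq_0_iff: "cubic_coeff t s = 0 \<longleftrightarrow> t = 0 \<or> t = s \<or> t = - s"
proof -
  have "cubic_coeff t s = t * (t - s) * (t + s)" by (simp add: cubic_coeff_def power2_eq_square power3_eq_cube algebra_simps)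
  then show ?thesis by (auto simp: eq_neg_iff_add_eq_0)
qed

lemma cubic_coeff_scale: "cubic_coeff (c * t) (c * s) = c ^ 3 * cubic_coeff t s"
  by (simp add: cubic_coeff_def power_mult_distrib algebra_simps power2_eq_square power3_eq_cube)

section \<open>Degenerate zeros as critical values\<close>

text \<open>\<open>w\<close> does not involve \<open>b\<close>, so \<open>\<Psi>\<close> is a fixed
  map, and \<open>b\<close> is \<open>\<Psi> z\<close> or its negative at every zero under
  consideration. If the zero is degenerate along \<open>h\<close>, the same \<open>b\<close> solves
  the equation at z + eps h to first order. So \<open>\<Psi>\<close> is stationary along
  \<open>h\<close>, and \<open>b\<close> is up to sign a critical value.\<close>

lemma negligible_singular_parameters:
  fixes a :: "'i \<Rightarrow> real^'n"
  assumes "finite I" "j \<in> I"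
  shows "negligible {b. \<exists>z h. cubic_map I (a(j := b)) x z = 0 \<and> cubic_map_deriv I (a(j := b)) x z h = 0 \<and>
           h \<noteq> 0 \<and> cubic_coeff (b \<bullet> z) (b \<bullet> x) \<noteq> 0}" (is "negligible ?B")
proof -
  \<comment> \<open>\<open>\<Psi>\<close> recovers \<open>b\<close> up to sign: a zero has \<open>w z = - c *\<^sub>R b\<close> with \<open>c = cubic_coeff (b \<bullet> z) (b \<bullet> x)\<close>,
    whence \<open>q z = - c ^ 4\<close>.\<close>
  define w where "w = cubic_map (I - {j}) a x"
  define w' where "w' = cubic_map_deriv (I - {j}) a x"
  define q where "q z = cubic_coeff (w z \<bullet> z) (w z \<bullet> x)" for z
  define q' where "q' z h = (3 * (w z \<bullet> z)\<^sup>2 - (w z \<bullet> x)\<^sup>2) * (w' z h \<bullet> z + w z \<bullet> h) -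
      2 * (w z \<bullet> x) * (w z \<bullet> z) * (w' z h \<bullet> x)" for z h
  define \<Psi> where "\<Psi> z = (- q z) powr (-1/4) *\<^sub>R w z" for z
  define \<Psi>' where "\<Psi>' z h = (- q z) powr (-1/4) *\<^sub>R w' z h + (1/4 * (- q z) powr (-5/4) * q' z h) *\<^sub>R w z" for z h
  \<comment> \<open>Where \<open>q z < 0\<close> the base \<open>- q z\<close> is positive and
    \<open>powr\<close> is differentiable.\<close>
  define S where "S = {z. q z < 0 \<and> (\<exists>h. h \<noteq> 0 \<and> \<Psi>' z h = 0)}"
  have dw: "(w has_derivative w' z) (at z)" for z
    unfolding w_def w'_def by (rule has_derivative_cubic_map)
  have dq: "(q has_derivative q' z) (at z)" for z
    unfolding q_def cubic_coeff_def
    by (rule derivative_eq_intros dw refl)+ (simp add: fun_eq_iff q'_def algebra_simps power2_eq_square)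
  have d\<Psi>: "(\<Psi> has_derivative \<Psi>' z) (at z)" if "q z < 0" for z
  proof -
    have "((\<lambda>y. y powr (-1/4)) has_real_derivative (-1/4) * (- q z) powr (-5/4)) (at (- q z))"
      using has_real_derivative_powr[of "- q z" "-1/4"] that by simp
    from has_derivative_compose[OF has_derivative_minus[OF dq] this[unfolded has_field_derivative_def]]
    have "((\<lambda>z. (- q z) powr (-1/4)) has_derivative (\<lambda>h. 1/4 * (- q z) powr (-5/4) * q' z h)) (at z)"
      by (simp add: algebra_simps)
    from has_derivative_scaleR[OF this dw] show ?thesis
      by (simp add: \<Psi>_def[abs_def] \<Psi>'_def[abs_def])
  qed
  have neg: "negligible (\<Psi> ` S)"
    by (rule Sard_equal_dim[where f' = \<Psi>']) (auto simp: S_def intro: d\<Psi>)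
  \<comment> \<open>\<open>\<Psi> z\<close> is w z / |c|, which loses the sign of c; hence the two
    images.\<close>
  have "?B \<subseteq> \<Psi> ` S \<union> uminus ` \<Psi> ` S"
  proof
    fix b assume "b \<in> ?B"
    then obtain z h where F: "cubic_map I (a(j := b)) x z = 0" and
      DF: "cubic_map_deriv I (a(j := b)) x z h = 0" and h: "h \<noteq> 0" and c0: "cubic_coeff (b \<bullet> z) (b \<bullet> x) \<noteq> 0"
      by blast
    define t s c \<kappa> where "t = b \<bullet> z" "s = b \<bullet> x" "c = cubic_coeff t s" "\<kappa> = (3 * t\<^sup>2 - s\<^sup>2) * (b \<bullet> h)"
    note ts = this
    have c: "c \<noteq> 0" using c0 by (simp add: ts)
    have wb: "w z = (- c) *\<^sub>R b"
      using F assms by (simp add: cubic_map_def sum.remove[of I j] w_def ts eq_neg_iff_add_eq_0 add.commute)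
    have w'b: "w' z h = (- \<kappa>) *\<^sub>R b"
      using DF assms by (simp add: cubic_map_deriv_def sum.remove[of I j] w'_def ts eq_neg_iff_add_eq_0 add.commute)
    have qz: "q z = - (c ^ 4)"
      using cubic_coeff_scale[of "- c" t s] by (simp add: q_def wb flip: ts) (simp add: eval_nat_numeral)
    have c_eq: "t ^ 3 = c + s\<^sup>2 * t" by (simp add: ts cubic_coeff_def)
    \<comment> \<open>This inserts w z = -c b and w' z h = -\<kappa> b. Since t^3 - s^2 t = c and
      the last product is c \<kappa>, the total is -(3 + 1) c^3 \<kappa>.\<close>
    have "q' z h = c\<^sup>2 * (- 3 * \<kappa> * (t ^ 3 - s\<^sup>2 * t) - c * ((3 * t\<^sup>2 - s\<^sup>2) * (b \<bullet> h)))"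
      by (simp add: q'_def wb w'b flip: ts(1,2))
         (simp add: power2_eq_square power3_eq_cube algebra_simps)
    also have "\<dots> = - 4 * c ^ 3 * \<kappa>"
      by (simp add: c_eq flip: ts(4)) (simp add: power2_eq_square power3_eq_cube algebra_simps)
    finally have q'z: "q' z h = - 4 * c ^ 3 * \<kappa>" .
    have c4: "c ^ 4 = \<bar>c\<bar> powr 4" using c by simp
    have p1: "(c ^ 4) powr (-1/4) = inverse \<bar>c\<bar>"
      unfolding c4 powr_powr using c by (simp add: powr_minus)
    have p2: "(c ^ 4) powr (-5/4) = inverse (\<bar>c\<bar> ^ 5)"
      unfolding c4 powr_powr using c by (simp add: powr_minus)
    have "\<bar>c\<bar> ^ 5 = c ^ 4 * \<bar>c\<bar>" by (simp add: eval_nat_numeral abs_mult_self_eq)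
    then have p3: "c ^ 4 * inverse (\<bar>c\<bar> ^ 5) = inverse \<bar>c\<bar>" using c by simp
    \<comment> \<open>The derivative of the scalar factor, 1/4 |c|^-5 (-4 c^3 \<kappa>), multiplies
      w z = -c b and cancels |c|^-1 w' z h = -|c|^-1 \<kappa> b.\<close>
    have "\<Psi>' z h = (\<kappa> * (c ^ 4 * inverse (\<bar>c\<bar> ^ 5)) - \<kappa> * inverse \<bar>c\<bar>) *\<^sub>R b"
      unfolding \<Psi>'_def qz q'z wb w'b minus_minus p1 p2
      by (simp add: scaleR_diff_left power4_eq_xxxx power3_eq_cube mult_ac)
    then have "\<Psi>' z h = 0" by (simp add: p3)
    with h c have zS: "z \<in> S" by (auto simp: S_def qz)
    have "\<Psi> z = b \<or> \<Psi> z = - b"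
      unfolding \<Psi>_def qz wb minus_minus p1 using c by (cases "c > 0") simp_all
    then show "b \<in> \<Psi> ` S \<union> uminus ` \<Psi> ` S"
      using zS by (force simp: image_iff)
  qed
  moreover have "negligible (uminus ` \<Psi> ` S)"
    by (rule negligible_differentiable_image_negligible[OF _ neg])
       (auto intro!: linear_imp_differentiable_on linear_uminus)
  ultimately show ?thesis using neg by (meson negligible_Un negligible_subset)
qed

section \<open>Finiteness of the set of zeros\<close>

text \<open>By spanning, z is determined by its inner products with the a_j, and each of these takes
  at most three values.\<close>

lemma finite_common_zeros_cubic_coeff:
  fixes a :: "'i \<Rightarrow> 'a::euclidean_space"
  assumes "finite I" and spanning: "\<And>z. (\<And>j. j \<in> I \<Longrightarrow> a j \<bullet> z = 0) \<Longrightarrow> z = 0"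
  shows "finite {z. \<forall>j\<in>I. cubic_coeff (a j \<bullet> z) (a j \<bullet> x) = 0}" (is "finite ?Z")
proof (rule inj_on_finite)
  show "inj_on (\<lambda>z. \<lambda>j\<in>I. a j \<bullet> z) ?Z"
  proof (rule inj_onI)
    fix y z assume *: "(\<lambda>j\<in>I. a j \<bullet> y) = (\<lambda>j\<in>I. a j \<bullet> z)"
    have "a j \<bullet> (y - z) = 0" if "j \<in> I" for j
      using fun_cong[OF *, of j] that by (simp add: inner_diff_right)
    then show "y = z" using spanning[of "y - z"] by simp
  qed
  show "(\<lambda>z. \<lambda>j\<in>I. a j \<bullet> z) ` ?Z \<subseteq> (\<Pi>\<^sub>E j\<in>I. {0, a j \<bullet> x, - (a j \<bullet> x)})"
    by (auto simp: cubic_coeff_eq_0_iff)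
  show "finite (\<Pi>\<^sub>E j\<in>I. {0, a j \<bullet> x, - (a j \<bullet> x)})"
    using assms(1) by (intro finite_PiE) auto
qed

lemma continuous_on_cubic_map: "continuous_on S (cubic_map I a x)"
  by (meson continuous_at_imp_continuous_on has_derivative_continuous has_derivative_cubic_map)

text \<open>The zero set is closed and bounded, and by nondegeneracy it contains none of its limit
  points, hence it is finite. For boundedness, pairing F(z) = 0 with z gives sum t_j^4 = sum s_j^2
  t_j^2, which is at most half of sum (t_j^4 + s_j^4); thus sum t_j^4 is at most
  \<open>C\<close>.\<close>

lemma finite_zeros_cubic_map:
  fixes a :: "'i \<Rightarrow> 'a::euclidean_space"
  assumes "finite I" and spanning: "\<And>z. (\<And>j. j \<in> I \<Longrightarrow> a j \<bullet> z = 0) \<Longrightarrow> z = 0"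
    and nondegenerate: "\<And>z h. cubic_map I a x z = 0 \<Longrightarrow> cubic_map_deriv I a x z h = 0 \<Longrightarrow> h = 0"
  shows "finite {z. cubic_map I a x z = 0}" (is "finite ?Z")
proof (rule ccontr)
  \<comment> \<open>The frame operator of the a_j. It is injective by spanning, hence bounded below,
    and turns bounds on the inner products into a bound on \<open>norm z\<close>.\<close>
  define L where "L z = (\<Sum>j\<in>I. (a j \<bullet> z) *\<^sub>R a j)" for z
  have linL: "linear L"
    by (auto intro!: linearI simp: L_def inner_add_right algebra_simps sum.distrib scaleR_sum_right)
  have "z = 0" if "L z = 0" for z
  proof (rule spanning)
    have "0 = (\<Sum>j\<in>I. (a j \<bullet> z)\<^sup>2)"
      using arg_cong[OF that, of "\<lambda>v. v \<bullet> z"] by (simp add: L_def inner_sum_left power2_eq_square)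
    then show "a j \<bullet> z = 0" if "j \<in> I" for j
      using sum_nonneg_eq_0_iff[of I "\<lambda>j. (a j \<bullet> z)\<^sup>2"] that \<open>finite I\<close> by simp
  qed
  then obtain B where B: "B > 0" "\<And>z. B * norm z \<le> norm (L z)"
    using linear_inj_bounded_below_pos[OF linL] linL by (metis linear_injective_0)
  define C where "C = (\<Sum>j\<in>I. (a j \<bullet> x) ^ 4)"
  define K where "K = (\<Sum>j\<in>I. (1 + C) * norm (a j))"
  have "norm z \<le> K / B" if z: "z \<in> ?Z" for z
  proof -
    have "0 = cubic_map I a x z \<bullet> z" using z by simp
    also have "\<dots> = (\<Sum>j\<in>I. (a j \<bullet> z) ^ 4 - (a j \<bullet> x)\<^sup>2 * (a j \<bullet> z)\<^sup>2)"
      by (simp add: cubic_map_def inner_sum_left cubic_coeff_def algebra_simps eval_nat_numeral)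
    also have "\<dots> \<ge> (\<Sum>j\<in>I. (1/2) * (a j \<bullet> z) ^ 4 - (1/2) * (a j \<bullet> x) ^ 4)"
    proof (rule sum_mono)
      fix j
      have "0 \<le> ((a j \<bullet> z)\<^sup>2 - (a j \<bullet> x)\<^sup>2)\<^sup>2" by simp
      then show "(1/2) * (a j \<bullet> z) ^ 4 - (1/2) * (a j \<bullet> x) ^ 4 \<le> (a j \<bullet> z) ^ 4 - (a j \<bullet> x)\<^sup>2 * (a j \<bullet> z)\<^sup>2"
        by (simp add: power2_diff algebra_simps flip: power_mult)
    qed
    finally have le: "(\<Sum>j\<in>I. (a j \<bullet> z) ^ 4) \<le> C"
      by (simp add: C_def sum_subtractf flip: sum_divide_distrib)
    \<comment> \<open>The bound 1 + C avoids fourth roots: a number exceeding 1 in modulus is at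
      most its own fourth power.\<close>
    have "\<bar>a j \<bullet> z\<bar> \<le> 1 + C" if "j \<in> I" for j
    proof (cases "\<bar>a j \<bullet> z\<bar> \<le> 1")
      case True
      moreover have "C \<ge> 0" by (simp add: C_def sum_nonneg)
      ultimately show ?thesis by simp
    next
      case False
      then have "\<bar>a j \<bullet> z\<bar> ^ 1 \<le> \<bar>a j \<bullet> z\<bar> ^ 4" by (intro power_increasing) auto
      also have "\<dots> \<le> (\<Sum>j\<in>I. (a j \<bullet> z) ^ 4)"
        using that \<open>finite I\<close> member_le_sum[of j I "\<lambda>j. (a j \<bullet> z) ^ 4"] by simp
      finally show ?thesis using le by simp
    qed
    then have "norm (L z) \<le> K"
      unfolding L_def K_def by (intro sum_norm_le) (simp add: mult_right_mono)
    with B(2)[of z] have "norm z * B \<le> K" by (simp add: mult.commute)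
    then show ?thesis using B(1) by (simp add: pos_le_divide_eq)
  qed
  then have "bounded ?Z" by (auto simp: bounded_iff)
  moreover have "closed ?Z"
    using continuous_closed_preimage_constant[OF continuous_on_cubic_map closed_UNIV] by simp
  ultimately have "compact ?Z" by (simp add: compact_eq_bounded_closed)
  moreover assume "infinite ?Z"
  ultimately obtain z where z: "cubic_map I a x z = 0" "z islimpt ?Z"
    unfolding compact_eq_Bolzano_Weierstrass by blast
  show False
    using isolated_zero_if_derivative_injective[OF has_derivative_cubic_map nondegenerate[OF z(1)] z(1)] z(2)
    by contradiction
qed

text \<open>Pairing the sum with \<open>h\<close> leaves a vanishing sum of nonnegative terms c_j
  (a_j.h)^2.\<close>

lemma quadratic_form_definite:
  assumes "finite I" and spanning: "\<And>z. (\<And>j. j \<in> I \<Longrightarrow> a j \<bullet> z = 0) \<Longrightarrow> z = 0"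
    and pos: "\<And>j. j \<in> I \<Longrightarrow> c j > 0" and zero: "(\<Sum>j\<in>I. (c j * (a j \<bullet> h)) *\<^sub>R a j) = 0"
  shows "h = (0 :: 'a::real_inner)"
proof (rule spanning)
  fix j assume j: "j \<in> I"
  have "(\<Sum>j\<in>I. c j * (a j \<bullet> h)\<^sup>2) = (\<Sum>j\<in>I. (c j * (a j \<bullet> h)) *\<^sub>R a j) \<bullet> h"
    by (simp add: inner_sum_left power2_eq_square mult.assoc)
  then have "(\<Sum>j\<in>I. c j * (a j \<bullet> h)\<^sup>2) = 0" using zero by simp
  then have "c j * (a j \<bullet> h)\<^sup>2 = 0"
    using j \<open>finite I\<close> pos by (subst (asm) sum_nonneg_eq_0_iff) (auto simp: less_imp_le)
  then show "a j \<bullet> h = 0" using pos[OF j] by simp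
qed

text \<open>Used when there are more than n vectors; \<open>regular\<close>, \<open>common\<close>
  and \<open>nz\<close> are then shown to hold almost surely. By \<open>regular\<close> a degenerate
  zero has all coefficients zero, and by \<open>common\<close> it is then 0, x or -x.\<close>

lemma finite_zeros_cubic_map_generic:
  fixes a :: "'i \<Rightarrow> 'a::euclidean_space"
  assumes "finite I" and spanning: "\<And>z. (\<And>j. j \<in> I \<Longrightarrow> a j \<bullet> z = 0) \<Longrightarrow> z = 0"
    and regular: "\<And>j z h. j \<in> I \<Longrightarrow> cubic_map I a x z = 0 \<Longrightarrow> cubic_map_deriv I a x z h = 0 \<Longrightarrow>
            cubic_coeff (a j \<bullet> z) (a j \<bullet> x) \<noteq> 0 \<Longrightarrow> h = 0"
    and common: "\<And>z. (\<And>j. j \<in> I \<Longrightarrow> cubic_coeff (a j \<bullet> z) (a j \<bullet> x) = 0) \<Longrightarrow> z = 0 \<or> z = x \<or> z = - x"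
    and nz: "\<And>j. x \<noteq> 0 \<Longrightarrow> j \<in> I \<Longrightarrow> a j \<bullet> x \<noteq> 0"
  shows "finite {z. cubic_map I a x z = 0}"
proof (cases "x = 0")
  \<comment> \<open>For x = 0 the zero z = 0 is degenerate, so this case is treated directly: F(z).z
    is a sum of fourth powers.\<close>
  case True
  have "z = 0" if "cubic_map I a x z = 0" for z
  proof (rule spanning)
    fix j assume j: "j \<in> I"
    have "(\<Sum>j\<in>I. (a j \<bullet> z) ^ 4) = cubic_map I a x z \<bullet> z"
      by (simp add: True cubic_map_def inner_sum_left cubic_coeff_def eval_nat_numeral mult_ac)
    with that have "(\<Sum>j\<in>I. (a j \<bullet> z) ^ 4) = 0" by simp
    then show "a j \<bullet> z = 0"
      using j \<open>finite I\<close> by (subst (asm) sum_nonneg_eq_0_iff) auto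
  qed
  then have "{z. cubic_map I a x z = 0} \<subseteq> {0}" by blast
  then show ?thesis by (rule finite_subset) simp
next
  case False
  show ?thesis
  proof (rule finite_zeros_cubic_map[OF \<open>finite I\<close> spanning])
    fix z h assume z: "cubic_map I a x z = 0" and h: "cubic_map_deriv I a x z h = 0"
    show "h = 0"
    proof (rule ccontr)
      assume "h \<noteq> 0"
      then have "cubic_coeff (a j \<bullet> z) (a j \<bullet> x) = 0" if "j \<in> I" for j
        using regular[OF that z h] by blast
      then have "z = 0 \<or> z = x \<or> z = - x" by (rule common)
      \<comment> \<open>The weight 3 t_j^2 - s_j^2 equals -s_j^2 at z = 0 and 2 s_j^2 at z = x and z
        = -x. Dividing by -1 or 2 leaves the weights s_j^2, positive by \<open>nz\<close>.\<close>
      then have "(\<Sum>j\<in>I. ((a j \<bullet> x)\<^sup>2 * (a j \<bullet> h)) *\<^sub>R a j) = 0"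
      proof (elim disjE)
        assume "z = 0"
        with h show ?thesis by (simp add: cubic_map_deriv_def sum_negf)
      next
        assume "z = x"
        with h have "(2::real) *\<^sub>R (\<Sum>j\<in>I. ((a j \<bullet> x)\<^sup>2 * (a j \<bullet> h)) *\<^sub>R a j) = 0"
          by (simp add: cubic_map_deriv_def scaleR_sum_right mult.assoc)
        then show ?thesis by simp
      next
        assume "z = - x"
        with h have "(2::real) *\<^sub>R (\<Sum>j\<in>I. ((a j \<bullet> x)\<^sup>2 * (a j \<bullet> h)) *\<^sub>R a j) = 0"
          by (simp add: cubic_map_deriv_def scaleR_sum_right mult.assoc)
        then show ?thesis by simp
      qed
      then have "h = 0"
        by (rule quadratic_form_definite[OF \<open>finite I\<close> spanning, rotated 2]) (use nz[OF False] in auto)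
      with \<open>h \<noteq> 0\<close> show False by contradiction
    qed
  qed
qed

section \<open>Critical points on the manifold\<close>

text \<open>Columns on the line through \<open>u\<close> make the entries v_j u_i; symmetry then
  makes \<open>v\<close> a multiple of \<open>u\<close>.\<close>

lemma M1_eq_scaled_outer:
  fixes Z :: "real^'n^'n"
  assumes "Z \<in> M1" "norm u = 1" "span {u} = span (columns Z)"
  obtains \<mu> where "Z = \<mu> *\<^sub>R outer u u"
proof -
  have "\<exists>k. column j Z = k *\<^sub>R u" for j
  proof -
    have "column j Z \<in> span {u}" unfolding assms(3) by (intro span_base) (auto simp: columns_def)
    then show ?thesis by (auto simp: span_singleton)
  qed
  then obtain v where v: "\<And>j. column j Z = v j *\<^sub>R u" by metis
  have Z: "Z $ i $ j = v j * u $ i" for i j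
    using arg_cong[OF v[of j], of "\<lambda>c. c $ i"] by (simp add: column_def)
  have sym: "Z $ i $ j = Z $ j $ i" for i j
    using assms(1) by (metis (mono_tags, lifting) M1_def mem_Collect_eq transpose_def vec_lambda_beta)
  \<comment> \<open>The factor is v.u: contracting column j with u gives v_j since |u| = 1, and
    contracting row j, equal by symmetry, gives \<mu> u_j.\<close>
  define \<mu> where "\<mu> = (\<Sum>i\<in>UNIV. v i * u $ i)"
  have "v j = \<mu> * u $ j" for j
  proof -
    have "v j = v j * (u \<bullet> u)" using assms(2) by (simp add: norm_eq_1)
    also have "\<dots> = (\<Sum>i\<in>UNIV. Z $ i $ j * u $ i)"
      by (simp add: inner_vec_def sum_distrib_left Z mult.assoc)
    also have "\<dots> = \<mu> * u $ j"
      unfolding sym[of _ j] by (simp add: Z \<mu>_def sum_distrib_right sum_distrib_left mult_ac)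
    finally show ?thesis .
  qed
  then have "Z = \<mu> *\<^sub>R outer u u" by (simp add: vec_eq_iff outer_def Z mult_ac)
  then show ?thesis by (rule that)
qed

lemma frob_outer_outer: "frob (outer a b) (outer u v) = (a \<bullet> u) * (b \<bullet> v)"
  by (simp add: frob_eq_inner inner_vec_def outer_def sum_product mult_ac)

text \<open>A vanishing Riemannian gradient makes the ambient gradient orthogonal to T_Z. Testing it
  against u y^T + y u^T for arbitrary y yields \<open>R = 0\<close>. Once \<mu> is known to be
  nonnegative, F(z) = sqrt(\<mu>) R for z = sqrt(\<mu>) u.\<close>

lemma critical_points_objective_subset:
  fixes a :: "nat \<Rightarrow> real^'n"
  assumes "m > 0" and spanning: "\<And>z. (\<And>j. j \<in> {1..m} \<Longrightarrow> a j \<bullet> z = 0) \<Longrightarrow> z = 0"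
  shows "critical_points (objective m a x) \<subseteq> (\<lambda>z. outer z z) ` {z. cubic_map {1..m} a x z = 0}"
proof
  fix Z assume "Z \<in> critical_points (objective m a x)"
  then have Z: "Z \<in> M1" and grad: "riemannian_gradient (objective m a x) Z = 0"
    by (auto simp: critical_points_def)
  obtain u where u: "norm u = 1" "span {u} = span (columns Z)" using M1_unit_vector[OF Z] .
  obtain \<mu> where \<mu>: "Z = \<mu> *\<^sub>R outer u u" using M1_eq_scaled_outer[OF Z u] .
  define G where "G = euclidean_gradient (objective m a x) Z"
  \<comment> \<open>The residual <A_j, Z - X>.\<close>
  define r where "r j = \<mu> * (a j \<bullet> u)\<^sup>2 - (a j \<bullet> x)\<^sup>2" for j
  define R where "R = (\<Sum>j=1..m. (r j * (a j \<bullet> u)) *\<^sub>R a j)"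
  have G: "frob G S = 0" if "S \<in> tangent_space Z" for S
    using orth_proj_props(2)[OF subspace_tangent_space[OF Z] that, of G] grad
    by (simp add: riemannian_gradient_def G_def)
  have uu: "u \<bullet> u = 1" using u(1) by (simp add: norm_eq_1)
  have R0: "R \<bullet> y = 0" for y
  proof -
    define v where "v = y - (y \<bullet> u) *\<^sub>R u"
    have y: "y = v + (y \<bullet> u) *\<^sub>R u" by (simp add: v_def)
    \<comment> \<open>Splitting y along u shows tangency for every y, with w = 2 (y.u); so
      \<open>R\<close> is tested against all vectors, not only those orthogonal to u.\<close>
    have "outer u y + outer y u = (2 * (y \<bullet> u)) *\<^sub>R outer u u + outer u v + outer v u"
      by (subst (1 2) y) (simp add: outer_add outer_scaleR algebra_simps flip: scaleR_left_distrib)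
    moreover have "v \<bullet> u = 0" by (simp add: v_def inner_diff_left uu)
    ultimately have "outer u y + outer y u \<in> tangent_space Z"
      unfolding tangent_space_unit[OF u] by blast
    from G[OF this] have "0 = frob G (outer u y + outer y u)" by simp
    also have "\<dots> = 2 / real m * (R \<bullet> y)"
    proof -
      have "frob (outer (a j) (a j)) (Z - outer x x) = r j" for j
        by (simp add: \<mu> r_def frob_eq_inner inner_diff_right frob_outer_outer[unfolded frob_eq_inner] power2_eq_square)
      then show ?thesis
        by (simp add: G_def euclidean_gradient_objective frob_eq_inner inner_add_right
            inner_sum_left frob_outer_outer[unfolded frob_eq_inner] R_def sum_distrib_left
            sum.distrib[symmetric] algebra_simps)
    qed
    finally show ?thesis using \<open>m > 0\<close> by simp
  qed
  then have R: "R = 0" by (metis inner_eq_zero_iff)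
  have "\<mu> \<ge> 0"
  proof (rule ccontr)
    assume neg: "\<not> \<mu> \<ge> 0"
    \<comment> \<open>For negative \<mu> all residuals are nonpositive, so R.u = 0 allows no
      cancellation. A nonzero a_j.u would make r_j strictly negative; hence u is orthogonal to all
      a_j, against spanning.\<close>
    have "(\<Sum>j=1..m. - (r j * (a j \<bullet> u)\<^sup>2)) = - (R \<bullet> u)"
      by (simp add: R_def inner_sum_left power2_eq_square mult.assoc sum_negf)
    then have sum0: "(\<Sum>j=1..m. - (r j * (a j \<bullet> u)\<^sup>2)) = 0" by (simp add: R)
    have r: "r j \<le> 0" for j
      using neg mult_nonpos_nonneg[of \<mu> "(a j \<bullet> u)\<^sup>2"] zero_le_power2[of "a j \<bullet> u"]
        zero_le_power2[of "a j \<bullet> x"] unfolding r_def by linarith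
    have "a j \<bullet> u = 0" if j: "j \<in> {1..m}" for j
    proof (rule ccontr)
      assume nz: "a j \<bullet> u \<noteq> 0"
      have "r j * (a j \<bullet> u)\<^sup>2 = 0"
        using sum0 j r by (subst (asm) sum_nonneg_eq_0_iff) (auto simp: mult_nonpos_nonneg)
      then have "r j = 0" using nz by simp
      moreover have "\<mu> * (a j \<bullet> u)\<^sup>2 < 0" using neg nz by (simp add: mult_neg_pos)
      ultimately show False using zero_le_power2[of "a j \<bullet> x"] unfolding r_def by linarith
    qed
    then have "u = 0" by (rule spanning)
    with u(1) show False by simp
  qed
  define z where "z = sqrt \<mu> *\<^sub>R u"
  have "cubic_map {1..m} a x z = sqrt \<mu> *\<^sub>R R"
    unfolding cubic_map_def R_def scaleR_sum_right
  proof (rule sum.cong)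
    fix j
    have "cubic_coeff (a j \<bullet> z) (a j \<bullet> x) = sqrt \<mu> * (r j * (a j \<bullet> u))"
      using \<open>\<mu> \<ge> 0\<close> by (simp add: z_def cubic_coeff_def r_def power3_eq_cube power2_eq_square algebra_simps)
    then show "cubic_coeff (a j \<bullet> z) (a j \<bullet> x) *\<^sub>R a j = sqrt \<mu> *\<^sub>R (r j * (a j \<bullet> u)) *\<^sub>R a j" by simp
  qed simp
  moreover have "Z = outer z z"
    using \<open>\<mu> \<ge> 0\<close> by (simp add: z_def \<mu> outer_scaleR)
  ultimately show "Z \<in> (\<lambda>z. outer z z) ` {z. cubic_map {1..m} a x z = 0}" by (simp add: R)
qed

section \<open>Almost sure statements by sections\<close>

text \<open>By compactness and continuity the quantifier over \<open>z\<close> reduces to a countable dense set.\<close>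

lemma sets_projection_compact:
  fixes H :: "'p \<Rightarrow> 'z::{metric_space,second_countable_topology} \<Rightarrow> real"
  assumes "compact K" and cont: "\<And>p. p \<in> space M \<Longrightarrow> continuous_on K (H p)"
    and meas: "\<And>z. z \<in> K \<Longrightarrow> (\<lambda>p. H p z) \<in> borel_measurable M"
  shows "{p \<in> space M. \<exists>z\<in>K. H p z = 0} \<in> sets M"
proof -
  obtain T where T: "countable T" "T \<subseteq> K" "K \<subseteq> closure T" using separable .
  have "{p \<in> space M. \<exists>z\<in>K. H p z = 0} = {p \<in> space M. \<forall>k. \<exists>z\<in>T. \<bar>H p z\<bar> < 1 / real (Suc k)}"
  proof (intro Collect_cong conj_cong refl iffI)
    fix p assume p: "p \<in> space M" and "\<exists>z\<in>K. H p z = 0"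
    then obtain z where z: "z \<in> K" "H p z = 0" by blast
    show "\<forall>k. \<exists>z\<in>T. \<bar>H p z\<bar> < 1 / real (Suc k)"
    proof
      fix k
      obtain d where d: "d > 0" "\<And>y. y \<in> K \<Longrightarrow> dist y z < d \<Longrightarrow> dist (H p y) (H p z) < 1 / real (Suc k)"
        using cont[OF p] z(1) unfolding continuous_on_iff by (metis of_nat_0_less_iff zero_less_Suc zero_less_divide_1_iff)
      obtain y where "y \<in> T" "dist y z < d"
        using T(3) z(1) d(1) by (meson closure_approachable subsetD)
      then show "\<exists>z\<in>T. \<bar>H p z\<bar> < 1 / real (Suc k)"
        using d(2)[of y] T(2) z(2) by (auto simp: dist_real_def)
    qed
  next
    fix p assume p: "p \<in> space M" and *: "\<forall>k. \<exists>z\<in>T. \<bar>H p z\<bar> < 1 / real (Suc k)"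
    then have "K \<noteq> {}" using T(2) by blast
    \<comment> \<open>The minimum of |H p| over the compact \<open>K\<close> is attained; values
      below 1/(k+1) on \<open>T\<close> for every k force it to be 0.\<close>
    then obtain z where z: "z \<in> K" "\<And>y. y \<in> K \<Longrightarrow> \<bar>H p z\<bar> \<le> \<bar>H p y\<bar>"
      using continuous_attains_inf[OF \<open>compact K\<close>, of "\<lambda>y. \<bar>H p y\<bar>"] cont[OF p]
      by (auto intro: continuous_on_rabs)
    have "H p z = 0"
    proof (rule ccontr)
      assume "H p z \<noteq> 0"
      then obtain k where "1 / real (Suc k) < \<bar>H p z\<bar>" using nat_approx_posE[of "\<bar>H p z\<bar>"] by auto
      then show False using * z(2) T(2) by (metis less_le_trans less_asym subsetD)
    qed
    with z(1) show "\<exists>z\<in>K. H p z = 0" by blast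
  qed
  also have "\<dots> \<in> sets M"
  proof (intro sets.sets_Collect_countable_All sets.sets_Collect_countable_Ex' T(1))
    fix k z assume "z \<in> T"
    then have [measurable]: "(\<lambda>p. H p z) \<in> borel_measurable M" using T(2) meas by blast
    show "{p \<in> space M. \<bar>H p z\<bar> < 1 / real (Suc k)} \<in> sets M" by measurable
  qed
  finally show ?thesis .
qed

text \<open>Makes the exceptional sets measurable, as Fubini's theorem requires. Closed balls
  exhaust the space, and the sets |g p z| \<ge> 1/(l+1) exhaust the open condition
  \<open>g p z \<noteq> 0\<close>; \<open>G\<close> merges this with \<open>H p z = 0\<close> into
  one continuous equation, so the compact case applies.\<close>

lemma sets_projection:
  fixes H g :: "'p \<Rightarrow> 'z::euclidean_space \<Rightarrow> real"
  assumes cont: "\<And>p. continuous_on UNIV (H p)" "\<And>p. continuous_on UNIV (g p)"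
    and meas: "\<And>z. (\<lambda>p. H p z) \<in> borel_measurable M" "\<And>z. (\<lambda>p. g p z) \<in> borel_measurable M"
  shows "{p \<in> space M. \<exists>z. H p z = 0 \<and> g p z \<noteq> 0} \<in> sets M"
proof -
  define G where "G l p z = \<bar>H p z\<bar> + max 0 (1 / real (Suc l) - \<bar>g p z\<bar>)" for l p z
  have G0: "G l p z = 0 \<longleftrightarrow> H p z = 0 \<and> 1 / real (Suc l) \<le> \<bar>g p z\<bar>" for l p z
    by (auto simp: G_def max_def)
  have "{p \<in> space M. \<exists>z. H p z = 0 \<and> g p z \<noteq> 0} =
      (\<Union>l. {p \<in> space M. \<exists>z\<in>cball 0 (real l). G l p z = 0})"
  proof (intro set_eqI iffI)
    fix p assume "p \<in> {p \<in> space M. \<exists>z. H p z = 0 \<and> g p z \<noteq> 0}"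
    then obtain z where z: "p \<in> space M" "H p z = 0" "g p z \<noteq> 0" by blast
    obtain k where k: "1 / real (Suc k) < \<bar>g p z\<bar>" using z nat_approx_posE[of "\<bar>g p z\<bar>"] by auto
    obtain k' where k': "norm z \<le> real k'" using real_arch_simple by blast
    define l where "l = max k k'"
    have "1 / real (Suc l) \<le> 1 / real (Suc k)" by (simp add: l_def frac_le)
    moreover have "norm z \<le> real l" using k' by (simp add: l_def)
    ultimately show "p \<in> (\<Union>l. {p \<in> space M. \<exists>z\<in>cball 0 (real l). G l p z = 0})"
      using z k by (auto simp: G0 intro!: exI[of _ l] bexI[of _ z])
  next
    fix p assume "p \<in> (\<Union>l. {p \<in> space M. \<exists>z\<in>cball 0 (real l). G l p z = 0})"
    then obtain l z where *: "p \<in> space M" "H p z = 0" "1 / real (Suc l) \<le> \<bar>g p z\<bar>" by (auto simp: G0)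
    moreover have "0 < 1 / real (Suc l)" by simp
    ultimately have "g p z \<noteq> 0" by linarith
    with * show "p \<in> {p \<in> space M. \<exists>z. H p z = 0 \<and> g p z \<noteq> 0}" by blast
  qed
  also have "\<dots> \<in> sets M"
  proof (intro sets.countable_UN subsetI)
    fix S assume "S \<in> range (\<lambda>l. {p \<in> space M. \<exists>z\<in>cball 0 (real l). G l p z = 0})"
    then obtain l where S: "S = {p \<in> space M. \<exists>z\<in>cball 0 (real l). G l p z = 0}" by blast
    show "S \<in> sets M"
      unfolding S
    proof (rule sets_projection_compact)
      show "continuous_on (cball 0 (real l)) (G l p)" for p
        unfolding G_def[abs_def]
        by (intro continuous_intros continuous_on_subset[OF cont(1)] continuous_on_subset[OF cont(2)]) auto
      note [measurable] = meas
      show "(\<lambda>p. G l p z) \<in> borel_measurable M" for z unfolding G_def by measurable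
    qed simp
  qed
  finally show ?thesis .
qed

section \<open>Null sets by Fubini's theorem\<close>

text \<open>By independence the joint law is the product of the law of \<open>X j\<close> and the
  law of the remaining variables. With the latter fixed, the values of \<open>X j\<close> leading
  into \<open>S\<close> form a Lebesgue null set, which \<open>ac\<close> makes null for the law of
  \<open>X j\<close>.\<close>

lemma (in prob_space) AE_not_in_if_sections_negligible:
  fixes X :: "'i \<Rightarrow> 'a \<Rightarrow> 'b::euclidean_space"
  assumes indep: "indep_vars (\<lambda>_. borel) X I" and "j \<in> I"
    and ac: "absolutely_continuous lborel (distr M borel (X j))"
    and S: "S \<in> sets (PiM I (\<lambda>_. borel))"
    and neg: "\<And>p. negligible {b. p(j := b) \<in> S}"
  shows "AE \<omega> in M. (\<lambda>i\<in>I. X i \<omega>) \<notin> S"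
proof -
  have rv: "random_variable borel (X i)" if "i \<in> I" for i
    using indep that by (auto simp: indep_vars_def)
  have meas: "(\<lambda>\<omega>. \<lambda>i\<in>I. X i \<omega>) \<in> measurable M (PiM I (\<lambda>_. borel))"
    by (intro measurable_restrict rv)
  define D where "D i = distr M borel (X i)" for i
  have D: "prob_space (D i)" if "i \<in> I" for i
    unfolding D_def by (intro prob_space_distr rv that)
  have I: "insert j (I - {j}) = I" using \<open>j \<in> I\<close> by blast
  have law: "distr M (PiM I (\<lambda>_. borel)) (\<lambda>\<omega>. \<lambda>i\<in>I. X i \<omega>) = PiM I D"
    using indep_vars_iff_distr_eq_PiM'[where I = I and M' = "\<lambda>_. borel" and X = X] indep rv \<open>j \<in> I\<close> by (auto simp: D_def[abs_def])
  let ?Q = "PiM (I - {j}) D"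
  interpret Dj: prob_space "D j" using \<open>j \<in> I\<close> by (rule D)
  interpret Q: prob_space ?Q by (rule prob_space_PiM) (use D in auto)
  interpret P: pair_sigma_finite "D j" ?Q ..
  have sets_D: "sets (PiM J D) = sets (PiM J (\<lambda>_. borel))" for J
    by (rule sets_PiM_cong) (simp_all add: D_def)
  have upd: "(\<lambda>(b, p). p(j := b)) \<in> measurable (D j \<Otimes>\<^sub>M ?Q) (PiM I D)"
    using measurable_comp[OF measurable_pair_swap' measurable_add_dim[of j "I - {j}" D]]
    by (simp only: I comp_def split_beta' fst_conv snd_conv)
  have S': "S \<in> sets (PiM I D)" using S sets_D by blast
  have pre: "{x \<in> space (D j \<Otimes>\<^sub>M ?Q). (snd x)(j := fst x) \<notin> S} \<in> sets (D j \<Otimes>\<^sub>M ?Q)"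
  proof -
    have "(\<lambda>(b, p). p(j := b)) -` (space (PiM I D) - S) \<inter> space (D j \<Otimes>\<^sub>M ?Q) \<in> sets (D j \<Otimes>\<^sub>M ?Q)"
      using S' by (intro measurable_sets[OF upd]) auto
    also have "(\<lambda>(b, p). p(j := b)) -` (space (PiM I D) - S) \<inter> space (D j \<Otimes>\<^sub>M ?Q) =
        {x \<in> space (D j \<Otimes>\<^sub>M ?Q). (snd x)(j := fst x) \<notin> S}"
      using measurable_space[OF upd] by (auto simp: split_beta')
    finally show ?thesis .
  qed
  have sec: "AE b in D j. p(j := b) \<notin> S" if p: "p \<in> space ?Q" for p
  proof -
    have "(\<lambda>b. p(j := b)) \<in> measurable (D j) (PiM I D)"
      using measurable_compose[OF measurable_Pair2'[OF p] upd] by (simp add: split_beta')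
    from measurable_sets[OF this S'] have "{b. p(j := b) \<in> S} \<in> sets lborel"
      by (simp add: D_def vimage_def)
    \<comment> \<open>Negligibility gives a null set of the completed measure; Borel measurability
      of the section brings it down to \<open>lborel\<close>.\<close>
    moreover have "{b. p(j := b) \<in> S} \<in> null_sets lebesgue"
      using neg by (simp add: negligible_iff_null_sets)
    ultimately have "{b. p(j := b) \<in> S} \<in> null_sets lborel"
      by (simp add: null_sets_completion_iff)
    then have "{b. p(j := b) \<in> S} \<in> null_sets (D j)"
      using ac by (auto simp: absolutely_continuous_def D_def)
    from AE_not_in[OF this] show ?thesis by simp
  qed
  \<comment> \<open>The sections are taken with \<open>p\<close> fixed, whereas the product has
    \<open>b\<close> in its first factor; hence the exchange of quantifiers.\<close>
  have "AE b in D j. AE p in ?Q. p(j := b) \<notin> S"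
    by (subst P.AE_commute[OF pre]) (use sec in \<open>auto intro: AE_I2\<close>)
  then have "AE x in D j \<Otimes>\<^sub>M ?Q. (snd x)(j := fst x) \<notin> S"
    by (intro P.AE_pair_measure) (use pre in auto)
  then have "AE y in distr (D j \<Otimes>\<^sub>M ?Q) (PiM I D) (\<lambda>(b, p). p(j := b)). y \<notin> S"
    using S' by (subst AE_distr_iff[OF upd]) (auto simp: split_beta')
  moreover have "distr (D j \<Otimes>\<^sub>M ?Q) (PiM I D) (\<lambda>(b, p). p(j := b)) = PiM I D"
    using distr_pair_PiM_eq_PiM[of "I - {j}" D j] D \<open>j \<in> I\<close> by (simp add: insert_absorb)
  ultimately have "AE y in PiM I D. y \<notin> S" by (simp only:)
  then show ?thesis
    unfolding law[symmetric] using S by (subst (asm) AE_distr_iff[OF meas]) auto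
qed

section \<open>The law of a Gaussian vector\<close>

lemma prod_Basis_cart: "(\<Prod>b\<in>Basis. f b) = (\<Prod>i\<in>UNIV. f (axis i 1 :: real^'n))"
proof -
  have eq: "Basis = (\<lambda>i. axis i 1 :: real^'n) ` UNIV" by (auto simp: Basis_vec_def)
  have inj: "inj (\<lambda>i. axis i 1 :: real^'n)" by (auto intro!: injI simp: axis_eq_axis)
  show ?thesis unfolding eq prod.reindex[OF inj] comp_def ..
qed

lemma measurable_vec_lambda: "(\<lambda>f. \<chi> i. f i) \<in> measurable (PiM UNIV (\<lambda>_. borel)) (borel :: (real^'n) measure)"
proof (subst borel_measurable_euclidean_space, intro ballI)
  fix b :: "real^'n" assume "b \<in> Basis"
  then obtain i where "b = axis i 1" by (auto simp: Basis_vec_def)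
  then show "(\<lambda>f. (\<chi> i. f i) \<bullet> b) \<in> borel_measurable (PiM UNIV (\<lambda>_. borel))"
    by (simp add: inner_axis)
qed

text \<open>Both measures assign to a box the product of its side lengths, and this characterizes
  \<open>lborel\<close>. Densities of coordinates can thereby be carried over to vectors.\<close>

lemma lborel_vec_eq_distr: "(lborel :: (real^'n) measure) = distr (PiM UNIV (\<lambda>_. lborel)) borel (\<lambda>f. \<chi> i. f i)"
proof (rule lborel_eqI)
  interpret product_sigma_finite "\<lambda>_::'n. lborel :: real measure" ..
  fix l u :: "real^'n" assume le: "\<And>b. b \<in> Basis \<Longrightarrow> l \<bullet> b \<le> u \<bullet> b"
  have le': "l $ i \<le> u $ i" for i
    using le[of "axis i 1"] by (simp add: inner_axis axis_in_Basis_iff)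
  have "emeasure (distr (PiM UNIV (\<lambda>_. lborel)) borel (\<lambda>f. \<chi> i. f i)) (box l u) =
      emeasure (PiM UNIV (\<lambda>_::'n. lborel)) (\<Pi>\<^sub>E i\<in>UNIV. {l $ i<..<u $ i})"
    using measurable_vec_lambda
    by (subst emeasure_distr)
       (auto simp: mem_box_cart space_PiM PiE_iff cong: measurable_cong_sets sets_PiM_cong intro!: arg_cong[where f="emeasure _"])
  also have "\<dots> = (\<Prod>i\<in>UNIV. emeasure lborel {l $ i<..<u $ i})"
    by (rule emeasure_PiM) auto
  also have "\<dots> = (\<Prod>i\<in>UNIV. ennreal (u $ i - l $ i))"
    using le' by simp
  also have "\<dots> = ennreal (\<Prod>b\<in>Basis. (u - l) \<bullet> b)"
    using le' by (simp add: prod_Basis_cart inner_axis prod_ennreal)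
  finally show "emeasure (distr (PiM UNIV (\<lambda>_. lborel)) borel (\<lambda>f. \<chi> i. f i)) (box l u) =
      ennreal (\<Prod>b\<in>Basis. (u - l) \<bullet> b)" .
qed simp

text \<open>Both sides agree on rectangles, where the integral of a product of one-variable
  functions factorizes.\<close>

lemma PiM_density_lborel:
  fixes f :: "'i \<Rightarrow> real \<Rightarrow> ennreal"
  assumes "finite I" and [measurable]: "\<And>i. f i \<in> borel_measurable borel"
    and prob: "\<And>i. prob_space (density lborel (f i))"
  shows "PiM I (\<lambda>i. density lborel (f i)) = density (PiM I (\<lambda>_. lborel)) (\<lambda>x. \<Prod>i\<in>I. f i (x i))"
proof -
  interpret L: product_sigma_finite "\<lambda>_::'i. lborel :: real measure" ..
  interpret D: product_prob_space "\<lambda>i. density lborel (f i)"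
    by (rule product_prob_spaceI) (rule prob)
  show ?thesis
  proof (rule D.PiM_eqI[OF \<open>finite I\<close>, symmetric])
    fix A assume A: "\<And>i. i \<in> I \<Longrightarrow> A i \<in> sets (density lborel (f i))"
    have "emeasure (density (PiM I (\<lambda>_. lborel)) (\<lambda>x. \<Prod>i\<in>I. f i (x i))) (Pi\<^sub>E I A) =
        (\<integral>\<^sup>+x. (\<Prod>i\<in>I. f i (x i)) * indicator (Pi\<^sub>E I A) x \<partial>PiM I (\<lambda>_. lborel))"
      using A \<open>finite I\<close> by (intro emeasure_density sets_PiM_I_finite) auto
    also have "\<dots> = (\<integral>\<^sup>+x. (\<Prod>i\<in>I. f i (x i) * indicator (A i) (x i)) \<partial>PiM I (\<lambda>_. lborel))"
      using \<open>finite I\<close>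
      by (intro nn_integral_cong) (auto simp: indicator_def space_PiM PiE_iff split: if_splits)
    also have "\<dots> = (\<Prod>i\<in>I. \<integral>\<^sup>+x. f i x * indicator (A i) x \<partial>lborel)"
      using A by (intro L.product_nn_integral_prod[OF \<open>finite I\<close>]) simp
    also have "\<dots> = (\<Prod>i\<in>I. emeasure (density lborel (f i)) (A i))"
      using A by (intro prod.cong refl emeasure_density[symmetric]) auto
    finally show "emeasure (density (PiM I (\<lambda>_. lborel)) (\<lambda>x. \<Prod>i\<in>I. f i (x i))) (Pi\<^sub>E I A) =
      (\<Prod>i\<in>I. emeasure (density lborel (f i)) (A i))" .
  qed (auto cong: sets_PiM_cong)
qed

text \<open>The joint law of the coordinates has a density with respect to product Lebesgue measure,
  and \<open>lborel\<close> is the image of that measure.\<close>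

lemma (in prob_space) absolutely_continuous_indep_coordinates:
  fixes X :: "'a \<Rightarrow> real^'n"
  assumes indep: "indep_vars (\<lambda>_. borel) (\<lambda>i \<omega>. X \<omega> $ i) UNIV"
    and dens: "\<And>i. distributed M lborel (\<lambda>\<omega>. X \<omega> $ i) (f i)"
  shows "absolutely_continuous lborel (distr M borel X)"
  unfolding absolutely_continuous_def
proof
  fix N :: "(real^'n) set" assume N: "N \<in> null_sets lborel"
  let ?v = "\<lambda>g. (\<chi> i. g i) :: real^'n"
  have rv: "random_variable borel (\<lambda>\<omega>. X \<omega> $ i)" for i
    using indep by (auto simp: indep_vars_def)
  have law1: "distr M borel (\<lambda>\<omega>. X \<omega> $ i) = density lborel (f i)" for i
    using distributed_distr_eq_density[OF dens[of i]] by (simp cong: distr_cong)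
  have [measurable]: "f i \<in> borel_measurable borel" for i
    using distributed_borel_measurable[OF dens[of i]] by simp
  have "prob_space (density lborel (f i))" for i
    unfolding law1[symmetric] by (rule prob_space_distr) (rule rv)
  then have law: "distr M (PiM UNIV (\<lambda>_. borel)) (\<lambda>\<omega> i. X \<omega> $ i) =
      density (PiM UNIV (\<lambda>_. lborel)) (\<lambda>g. \<Prod>i\<in>UNIV. f i (g i))"
    using indep_vars_iff_distr_eq_PiM[where I = UNIV and M' = "\<lambda>_. borel" and X = "\<lambda>i \<omega>. X \<omega> $ i"] indep rv
    by (simp add: law1 PiM_density_lborel restrict_UNIV)
  have mX: "(\<lambda>\<omega> i. X \<omega> $ i) \<in> measurable M (PiM UNIV (\<lambda>_. borel))"
    using measurable_restrict[of UNIV "\<lambda>i \<omega>. X \<omega> $ i" M "\<lambda>_. borel"] rv by (simp add: restrict_UNIV)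
  have distr_X: "distr M borel X = distr (distr M (PiM UNIV (\<lambda>_. borel)) (\<lambda>\<omega> i. X \<omega> $ i)) borel ?v"
    using distr_distr[OF measurable_vec_lambda mX] by (simp add: comp_def)
  have mv: "?v \<in> measurable (PiM UNIV (\<lambda>_::'n. lborel)) borel"
    using measurable_vec_lambda by (simp cong: measurable_cong_sets sets_PiM_cong)
  have "N \<in> null_sets (distr (PiM UNIV (\<lambda>_. lborel)) borel ?v)"
    using N by (simp flip: lborel_vec_eq_distr)
  then have "AE g in PiM UNIV (\<lambda>_. lborel). ?v g \<notin> N"
    using AE_not_in AE_distrD[OF mv] by blast
  then have "AE g in density (PiM UNIV (\<lambda>_. lborel)) (\<lambda>g. \<Prod>i\<in>UNIV. f i (g i)). ?v g \<notin> N"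
    by (subst AE_density) auto
  then have "AE y in distr M borel X. y \<notin> N"
    unfolding distr_X law using N
    by (subst AE_distr_iff) (auto simp: mv)
  then show "N \<in> null_sets (distr M borel X)"
    using N by (subst (asm) AE_iff_null_sets[symmetric]) auto
qed

text \<open>Entries are grouped by their vector index: disjoint blocks of an independent family are
  independent, and within block j the coordinates stay independent.\<close>

lemma (in prob_space) iid_std_gaussian_vectors:
  fixes a :: "nat \<Rightarrow> 'a \<Rightarrow> real^'n"
  assumes "iid_std_gaussian_entries m a"
  shows "indep_vars (\<lambda>_. borel) a {1..m}"
    and "j \<in> {1..m} \<Longrightarrow> absolutely_continuous lborel (distr M borel (a j))"
proof -
  let ?X = "\<lambda>(j, i) \<omega>. a j \<omega> $ i"
  have indep: "indep_vars (\<lambda>_. borel) ?X ({1..m} \<times> UNIV)"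
    and dens: "\<And>j i. j \<in> {1..m} \<Longrightarrow> distributed M lborel (\<lambda>\<omega>. a j \<omega> $ i) std_normal_density"
    using assms by (auto simp: iid_std_gaussian_entries_def)
  have "indep_vars (\<lambda>j. PiM ({j} \<times> UNIV) (\<lambda>_. borel)) (\<lambda>j \<omega>. restrict (\<lambda>p. ?X p \<omega>) ({j} \<times> UNIV)) {1..m}"
    by (rule indep_vars_restrict[OF indep]) (auto simp: disjoint_family_on_def)
  then have "indep_vars (\<lambda>_. borel)
      (\<lambda>j \<omega>. (\<lambda>f. \<chi> i. f (j, i)) (restrict (\<lambda>p. ?X p \<omega>) ({j} \<times> UNIV))) {1..m}"
  proof (rule indep_vars_compose2)
    fix j
    have "(\<lambda>f. \<lambda>i\<in>UNIV. f (j, i)) \<in> measurable (PiM ({j} \<times> UNIV) (\<lambda>_. borel :: real measure)) (PiM (UNIV :: 'n set) (\<lambda>_. borel))"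
      by (intro measurable_restrict measurable_component_singleton) auto
    from measurable_compose[OF this measurable_vec_lambda]
    show "(\<lambda>f. \<chi> i. f (j, i)) \<in> measurable (PiM ({j} \<times> UNIV) (\<lambda>_. borel)) (borel :: (real^'n) measure)"
      by simp
  qed
  then show "indep_vars (\<lambda>_. borel) a {1..m}" by simp
  show "absolutely_continuous lborel (distr M borel (a j))" if j: "j \<in> {1..m}"
  proof (rule absolutely_continuous_indep_coordinates[OF _ dens[OF j]])
    \<comment> \<open>Singleton blocks reindex the entries of vector j by the coordinate
      alone.\<close>
    have "indep_vars (\<lambda>i. PiM {(j, i)} (\<lambda>_. borel)) (\<lambda>i \<omega>. restrict (\<lambda>p. ?X p \<omega>) {(j, i)}) UNIV"
      by (rule indep_vars_restrict[OF indep]) (use j in \<open>auto simp: disjoint_family_on_def\<close>)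
    then have "indep_vars (\<lambda>_. borel) (\<lambda>i \<omega>. (\<lambda>f. f (j, i)) (restrict (\<lambda>p. ?X p \<omega>) {(j, i)})) UNIV"
      by (rule indep_vars_compose2) (intro measurable_component_singleton, simp)
    then show "indep_vars (\<lambda>_. borel) (\<lambda>i \<omega>. a j \<omega> $ i) UNIV" by simp
  qed
qed

section \<open>Generic vectors\<close>

text \<open>The n independent vectors form a basis, so \<open>z\<close> is a combination of the a_i
  and z.z = 0. The coefficients form a vector of type \<open>real^'n\<close>, over which
  \<open>sets_projection\<close> can quantify.\<close>

lemma spanning_if_independent:
  fixes a :: "'n::finite \<Rightarrow> real^'n"
  assumes indep: "\<And>c :: real^'n. (\<Sum>i\<in>UNIV. c $ i *\<^sub>R a i) = 0 \<Longrightarrow> c = 0"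
    and orth: "\<And>i. a i \<bullet> z = 0"
  shows "z = 0"
proof -
  define L where "L c = (\<Sum>i\<in>UNIV. c $ i *\<^sub>R a i)" for c :: "real^'n"
  have lin: "linear L"
    by (auto intro!: linearI simp: L_def algebra_simps sum.distrib scaleR_sum_right)
  then have "inj L" using indep by (simp add: linear_injective_0 L_def)
  then have "surj L" using lin by (intro linear_inj_imp_surj)
  then obtain c where "z = L c" by (metis surjD)
  then have "z \<bullet> z = (\<Sum>i\<in>UNIV. c $ i * (a i \<bullet> z))" by (simp add: L_def inner_sum_left)
  then show ?thesis by (simp add: orth)
qed

text \<open>\<open>c $ k \<noteq> 0\<close> allows solving for \<open>b\<close>, which then lies in
  the span of n - 1 vectors. Injectivity of \<pi> keeps the update away from these.\<close>

lemma negligible_dependent_parameters: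
  fixes p :: "'i \<Rightarrow> real^'n" and \<pi> :: "'n \<Rightarrow> 'i"
  assumes "inj \<pi>"
  shows "negligible {b. \<exists>c :: real^'n. (\<Sum>i\<in>UNIV. c $ i *\<^sub>R (p(\<pi> k := b)) (\<pi> i)) = 0 \<and> c $ k \<noteq> 0}"
proof -
  let ?V = "(\<lambda>i. p (\<pi> i)) ` (UNIV - {k})"
  have "dim ?V \<le> card ?V" by (rule dim_le_card') simp
  also have "\<dots> \<le> card (UNIV - {k})" by (rule card_image_le) simp
  also have "\<dots> < CARD('n)" by (rule psubset_card_mono) auto
  finally have "negligible (span ?V)" by (intro negligible_lowdim) (simp add: dim_span)
  moreover have "{b. \<exists>c :: real^'n. (\<Sum>i\<in>UNIV. c $ i *\<^sub>R (p(\<pi> k := b)) (\<pi> i)) = 0 \<and> c $ k \<noteq> 0} \<subseteq> span ?V"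
  proof clarify
    fix b and c :: "real^'n"
    assume sum0: "(\<Sum>i\<in>UNIV. c $ i *\<^sub>R (p(\<pi> k := b)) (\<pi> i)) = 0" and ck: "c $ k \<noteq> 0"
    define s where "s = (\<Sum>i\<in>UNIV - {k}. c $ i *\<^sub>R p (\<pi> i))"
    have "(\<Sum>i\<in>UNIV - {k}. c $ i *\<^sub>R (p(\<pi> k := b)) (\<pi> i)) = s"
      unfolding s_def using \<open>inj \<pi>\<close> by (intro sum.cong) (auto simp: inj_eq)
    then have "c $ k *\<^sub>R b + s = 0"
      using sum0 by (simp add: sum.remove[of UNIV k])
    then have "b = (- inverse (c $ k)) *\<^sub>R s"
      using ck by (simp add: add_eq_0_iff flip: scaleR_minus_left)
    moreover have "s \<in> span ?V"
      unfolding s_def by (intro span_sum span_scale span_base) auto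
    ultimately show "b \<in> span ?V" by (metis span_scale)
  qed
  ultimately show ?thesis by (rule negligible_subset)
qed

text \<open>A zero coefficient means that \<open>b\<close> is orthogonal to z, z - x or z + x, all
  nonzero here: a finite union of hyperplanes.\<close>

lemma negligible_common_zero_parameters:
  fixes Z :: "'a::euclidean_space set"
  assumes "finite Z"
  shows "negligible {b. \<exists>z\<in>Z. z \<noteq> 0 \<and> z \<noteq> x \<and> z \<noteq> - x \<and> cubic_coeff (b \<bullet> z) (b \<bullet> x) = 0}"
proof -
  have "negligible (\<Union>z\<in>Z - {0, x, - x}. {b. z \<bullet> b = 0} \<union> {b. (z - x) \<bullet> b = 0} \<union> {b. (z + x) \<bullet> b = 0})"
    using assms
    by (intro negligible_Union)
       (auto intro!: negligible_Un negligible_hyperplane simp: eq_neg_iff_add_eq_0)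
  moreover have "{b. \<exists>z\<in>Z. z \<noteq> 0 \<and> z \<noteq> x \<and> z \<noteq> - x \<and> cubic_coeff (b \<bullet> z) (b \<bullet> x) = 0} \<subseteq>
      (\<Union>z\<in>Z - {0, x, - x}. {b. z \<bullet> b = 0} \<union> {b. (z - x) \<bullet> b = 0} \<union> {b. (z + x) \<bullet> b = 0})"
  proof clarify
    fix b z assume z: "z \<in> Z" "z \<noteq> 0" "z \<noteq> x" "z \<noteq> - x" and "cubic_coeff (b \<bullet> z) (b \<bullet> x) = 0"
    then have "z \<bullet> b = 0 \<or> (z - x) \<bullet> b = 0 \<or> (z + x) \<bullet> b = 0"
      by (auto simp: cubic_coeff_eq_0_iff inner_diff_left inner_add_left inner_commute[of z b] inner_commute[of x b])
    with z show "b \<in> (\<Union>z\<in>Z - {0, x, - x}. {b. z \<bullet> b = 0} \<union> {b. (z - x) \<bullet> b = 0} \<union> {b. (z + x) \<bullet> b = 0})"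
      by blast
  qed
  ultimately show ?thesis by (rule negligible_subset)
qed

lemma cubic_map_cong:
  assumes "\<And>j. j \<in> I \<Longrightarrow> a j = b j"
  shows "cubic_map I a = cubic_map I b" "cubic_map_deriv I a = cubic_map_deriv I b"
  using assms by (auto simp: fun_eq_iff cubic_map_def cubic_map_deriv_def intro!: sum.cong)

section \<open>Almost sure genericity of independent vectors\<close>

locale independent_ac_vectors = prob_space M for M :: "'w measure" +
  fixes I :: "'i set" and a :: "'i \<Rightarrow> 'w \<Rightarrow> real^'n"
  assumes fin: "finite I" and indep: "indep_vars (\<lambda>_. borel) a I"
    and ac: "\<And>j. j \<in> I \<Longrightarrow> absolutely_continuous lborel (distr M borel (a j))"
begin

abbreviation "P \<equiv> PiM I (\<lambda>_. borel :: (real^'n) measure)"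

lemma in_space: "(\<lambda>i\<in>I. a i \<omega>) \<in> space P"
  by (simp add: space_PiM)

lemma AE_not_in:
  assumes "j \<in> I" "S \<in> sets P" "\<And>p. negligible {b. p(j := b) \<in> S}"
  shows "AE \<omega> in M. (\<lambda>i\<in>I. a i \<omega>) \<notin> S"
  using AE_not_in_if_sections_negligible[OF indep assms(1) ac[OF assms(1)] assms(2,3)] .

lemma sets_dependent:
  fixes \<pi> :: "'n \<Rightarrow> 'i" and g :: "real^'n \<Rightarrow> real"
  assumes "range \<pi> \<subseteq> I" "continuous_on UNIV g"
  shows "{p \<in> space P. \<exists>c. (\<Sum>i\<in>UNIV. c $ i *\<^sub>R p (\<pi> i)) = 0 \<and> g c \<noteq> 0} \<in> sets P"
proof -
  have [measurable]: "(\<lambda>p. p (\<pi> i)) \<in> borel_measurable P" for i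
    using assms(1) by (intro measurable_component_singleton) auto
  \<comment> \<open>The norm turns the vector equation into a real one, as
    \<open>sets_projection\<close> expects.\<close>
  have "{p \<in> space P. \<exists>c. norm (\<Sum>i\<in>UNIV. c $ i *\<^sub>R p (\<pi> i)) = 0 \<and> g c \<noteq> 0} \<in> sets P"
    by (intro sets_projection continuous_intros assms(2)) measurable
  then show ?thesis by simp
qed

text \<open>A nontrivial relation has a nonzero coefficient at some k; for each k the vector with
  index \<pi> k is varied while the others are fixed.\<close>

lemma AE_independent:
  fixes \<pi> :: "'n \<Rightarrow> 'i"
  assumes "inj \<pi>" "range \<pi> \<subseteq> I"
  shows "AE \<omega> in M. \<forall>c :: real^'n. (\<Sum>i\<in>UNIV. c $ i *\<^sub>R a (\<pi> i) \<omega>) = 0 \<longrightarrow> c = 0"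
proof -
  let ?S = "\<lambda>k. {p \<in> space P. \<exists>c :: real^'n. (\<Sum>i\<in>UNIV. c $ i *\<^sub>R p (\<pi> i)) = 0 \<and> c $ k \<noteq> 0}"
  have "AE \<omega> in M. (\<lambda>i\<in>I. a i \<omega>) \<notin> ?S k" for k
  proof (rule AE_not_in)
    show "\<pi> k \<in> I" using assms by blast
    show "?S k \<in> sets P"
      by (intro sets_dependent assms continuous_intros)
    show "negligible {b. p(\<pi> k := b) \<in> ?S k}" for p
      by (rule negligible_subset[OF negligible_dependent_parameters[OF assms(1), of p k]]) auto
  qed
  then have "AE \<omega> in M. \<forall>k. (\<lambda>i\<in>I. a i \<omega>) \<notin> ?S k" by (intro AE_all_countable[THEN iffD2] allI)
  then show ?thesis
  proof eventually_elim
    case (elim \<omega>)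
    have "\<pi> i \<in> I" for i using assms by blast
    then show ?case using elim in_space[of \<omega>] by (simp add: vec_eq_iff) metis
  qed
qed

lemma AE_regular:
  "AE \<omega> in M. \<forall>j\<in>I. \<forall>z h. cubic_map I (\<lambda>j. a j \<omega>) x z = 0 \<longrightarrow>
     cubic_map_deriv I (\<lambda>j. a j \<omega>) x z h = 0 \<longrightarrow> cubic_coeff (a j \<omega> \<bullet> z) (a j \<omega> \<bullet> x) \<noteq> 0 \<longrightarrow> h = 0"
proof -
  \<comment> \<open>The pair \<open>y\<close> stands for (z, h). The sum of norms encodes the two
    equations and the product the two inequations.\<close>
  let ?S = "\<lambda>j. {p \<in> space P. \<exists>y. norm (cubic_map I p x (fst y)) + norm (cubic_map_deriv I p x (fst y) (snd y)) = 0 \<and>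
      norm (snd y) * cubic_coeff (p j \<bullet> fst y) (p j \<bullet> x) \<noteq> 0}"
  have [measurable]: "(\<lambda>p. p j) \<in> borel_measurable P" if "j \<in> I" for j
    using that by (intro measurable_component_singleton) auto
  have "AE \<omega> in M. (\<lambda>i\<in>I. a i \<omega>) \<notin> ?S j" if j: "j \<in> I" for j
  proof (rule AE_not_in[OF j])
    show "?S j \<in> sets P"
    proof (rule sets_projection)
      fix p :: "'i \<Rightarrow> real^'n" and y :: "(real^'n) \<times> (real^'n)"
      show "continuous_on UNIV (\<lambda>y. norm (cubic_map I p x (fst y)) + norm (cubic_map_deriv I p x (fst y) (snd y)))"
        unfolding cubic_map_def cubic_map_deriv_def cubic_coeff_def by (intro continuous_intros)
      show "continuous_on UNIV (\<lambda>y. norm (snd y) * cubic_coeff (p j \<bullet> fst y) (p j \<bullet> x))"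
        unfolding cubic_coeff_def by (intro continuous_intros)
      show "(\<lambda>p. norm (cubic_map I p x (fst y)) + norm (cubic_map_deriv I p x (fst y) (snd y))) \<in> borel_measurable P"
        unfolding cubic_map_def cubic_map_deriv_def cubic_coeff_def by measurable
      show "(\<lambda>p. norm (snd y) * cubic_coeff (p j \<bullet> fst y) (p j \<bullet> x)) \<in> borel_measurable P"
        unfolding cubic_coeff_def using j by measurable
    qed
    show "negligible {b. p(j := b) \<in> ?S j}" for p
      by (rule negligible_subset[OF negligible_singular_parameters[OF fin j, of p x]])
         (auto simp: add_nonneg_eq_0_iff)
  qed
  then have "AE \<omega> in M. \<forall>j\<in>I. (\<lambda>i\<in>I. a i \<omega>) \<notin> ?S j" by (intro AE_finite_all[OF fin, THEN iffD2] ballI)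
  then show ?thesis
  proof eventually_elim
    case (elim \<omega>)
    show ?case
      using elim in_space[of \<omega>] cubic_map_cong[of I "\<lambda>i\<in>I. a i \<omega>" "\<lambda>i. a i \<omega>"]
      by (auto simp: add_nonneg_eq_0_iff)
  qed
qed

text \<open>The n vectors chosen by \<pi> leave finitely many candidates z. The further vector a_j,
  independent of them, almost surely avoids the hyperplanes that would keep a candidate other than
  0, x and -x.\<close>

lemma AE_common_zeros:
  fixes \<pi> :: "'n \<Rightarrow> 'i"
  assumes "inj \<pi>" "range \<pi> \<subseteq> I" "j \<in> I" "j \<notin> range \<pi>"
  shows "AE \<omega> in M. \<forall>z. (\<forall>j\<in>I. cubic_coeff (a j \<omega> \<bullet> z) (a j \<omega> \<bullet> x) = 0) \<longrightarrow> z = 0 \<or> z = x \<or> z = - x"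
proof -
  let ?D = "{p \<in> space P. \<exists>c :: real^'n. (\<Sum>i\<in>UNIV. c $ i *\<^sub>R p (\<pi> i)) = 0 \<and> norm c \<noteq> 0}"
  let ?S = "{p \<in> space P. \<exists>z. (\<Sum>j\<in>I. \<bar>cubic_coeff (p j \<bullet> z) (p j \<bullet> x)\<bar>) = 0 \<and>
      norm z * norm (z - x) * norm (z + x) \<noteq> 0}"
  have [measurable]: "(\<lambda>p. p j) \<in> borel_measurable P" if "j \<in> I" for j
    using that by (intro measurable_component_singleton) auto
  have S: "p \<in> ?S \<longleftrightarrow> p \<in> space P \<and> (\<exists>z. (\<forall>j\<in>I. cubic_coeff (p j \<bullet> z) (p j \<bullet> x) = 0) \<and> z \<noteq> 0 \<and> z \<noteq> x \<and> z \<noteq> - x)" for p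
    by (simp add: sum_nonneg_eq_0_iff[OF fin] eq_neg_iff_add_eq_0)
  \<comment> \<open>The sections of \<open>?S\<close> alone need not be negligible; removing the null set \<open>?D\<close> makes them so.\<close>
  have "AE \<omega> in M. (\<lambda>i\<in>I. a i \<omega>) \<notin> ?S - ?D"
  proof (rule AE_not_in[OF \<open>j \<in> I\<close>])
    have "?D \<in> sets P"
      by (intro sets_dependent assms continuous_intros)
    moreover have "?S \<in> sets P"
    proof (rule sets_projection)
      fix p :: "'i \<Rightarrow> real^'n" and z :: "real^'n"
      show "continuous_on UNIV (\<lambda>z. \<Sum>j\<in>I. \<bar>cubic_coeff (p j \<bullet> z) (p j \<bullet> x)\<bar>)"
        unfolding cubic_coeff_def by (intro continuous_intros)
      show "continuous_on UNIV (\<lambda>z. norm z * norm (z - x) * norm (z + x))"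
        by (intro continuous_intros)
      show "(\<lambda>p. \<Sum>j\<in>I. \<bar>cubic_coeff (p j \<bullet> z) (p j \<bullet> x)\<bar>) \<in> borel_measurable P"
        unfolding cubic_coeff_def by measurable
    qed simp
    ultimately show "?S - ?D \<in> sets P" by (rule sets.Diff[rotated])
    show "negligible {b. p(j := b) \<in> ?S - ?D}" for p
    proof (cases "\<exists>c :: real^'n. (\<Sum>i\<in>UNIV. c $ i *\<^sub>R p (\<pi> i)) = 0 \<and> c \<noteq> 0")
      case True
      \<comment> \<open>As \<open>j\<close> lies outside the range of \<pi>, changing
        \<open>p\<close> at \<open>j\<close> preserves the relation; every updated point in the
        space of \<open>P\<close> thus lies in \<open>?D\<close>.\<close>
      have upd: "(p(j := b)) (\<pi> i) = p (\<pi> i)" for b i using assms(4) by auto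
      have "{b. p(j := b) \<in> ?S - ?D} = {}"
      proof (intro equals0I)
        fix b assume "b \<in> {b. p(j := b) \<in> ?S - ?D}"
        then have b: "p(j := b) \<in> space P" "p(j := b) \<notin> ?D" by blast+
        then show False using True by (simp only: mem_Collect_eq upd norm_eq_zero) blast
      qed
      then show ?thesis by (simp only: negligible_empty)
    next
      case False
      let ?Z = "{z. \<forall>j\<in>range \<pi>. cubic_coeff (p j \<bullet> z) (p j \<bullet> x) = 0}"
      have "finite ?Z"
      proof (rule finite_common_zeros_cubic_coeff)
        fix z assume "\<And>j. j \<in> range \<pi> \<Longrightarrow> p j \<bullet> z = 0"
        then show "z = 0" by (rule spanning_if_independent[of "\<lambda>i. p (\<pi> i)", rotated]) (use False in auto)
      qed simp
      moreover have "{b. p(j := b) \<in> ?S - ?D} \<subseteq>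
          {b. \<exists>z\<in>?Z. z \<noteq> 0 \<and> z \<noteq> x \<and> z \<noteq> - x \<and> cubic_coeff (b \<bullet> z) (b \<bullet> x) = 0}"
      proof
        fix b assume "b \<in> {b. p(j := b) \<in> ?S - ?D}"
        then have "p(j := b) \<in> ?S" by blast
        then obtain z where z: "\<And>k. k \<in> I \<Longrightarrow> cubic_coeff ((p(j := b)) k \<bullet> z) ((p(j := b)) k \<bullet> x) = 0"
            "z \<noteq> 0" "z \<noteq> x" "z \<noteq> - x"
          unfolding S by blast
        have "z \<in> ?Z"
        proof (intro CollectI ballI)
          fix k assume "k \<in> range \<pi>"
          then show "cubic_coeff (p k \<bullet> z) (p k \<bullet> x) = 0" using z(1)[of k] assms by (metis fun_upd_other subsetD)
        qed
        with z(2-) z(1)[OF \<open>j \<in> I\<close>] show "b \<in> {b. \<exists>z\<in>?Z. z \<noteq> 0 \<and> z \<noteq> x \<and> z \<noteq> - x \<and> cubic_coeff (b \<bullet> z) (b \<bullet> x) = 0}"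
          by auto
      qed
      ultimately show ?thesis by (rule negligible_subset[OF negligible_common_zero_parameters])
    qed
  qed
  with AE_independent[OF assms(1,2)] show ?thesis
  proof eventually_elim
    case (elim \<omega>)
    have "\<pi> i \<in> I" for i using assms by blast
    then have "(\<lambda>i\<in>I. a i \<omega>) \<notin> ?D" using elim(1) by auto
    then have "(\<lambda>i\<in>I. a i \<omega>) \<notin> ?S" using elim(2) by blast
    then show ?case unfolding S using in_space[of \<omega>] by auto
  qed
qed

lemma AE_inner_nonzero:
  assumes "x \<noteq> 0"
  shows "AE \<omega> in M. \<forall>j\<in>I. a j \<omega> \<bullet> x \<noteq> 0"
proof -
  have "AE \<omega> in M. (\<lambda>i\<in>I. a i \<omega>) \<notin> {p \<in> space P. p j \<bullet> x = 0}" if j: "j \<in> I" for j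
  proof (rule AE_not_in[OF j])
    have [measurable]: "(\<lambda>p. p j) \<in> borel_measurable P"
      using j by (intro measurable_component_singleton) auto
    show "{p \<in> space P. p j \<bullet> x = 0} \<in> sets P" by measurable
    show "negligible {b. p(j := b) \<in> {p \<in> space P. p j \<bullet> x = 0}}" for p
      by (rule negligible_subset[OF negligible_hyperplane[of x 0]]) (use assms in \<open>auto simp: inner_commute\<close>)
  qed
  then have "AE \<omega> in M. \<forall>j\<in>I. (\<lambda>i\<in>I. a i \<omega>) \<notin> {p \<in> space P. p j \<bullet> x = 0}"
    by (intro AE_finite_all[OF fin, THEN iffD2] ballI)
  then show ?thesis
    by eventually_elim (use in_space in auto)
qed

text \<open>The spanning property is carried along because the passage from critical points to zeros
  of F relies on it.\<close>

lemma AE_finite_zeros: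
  assumes "card I \<ge> CARD('n)"
  shows "AE \<omega> in M. (\<forall>z. (\<forall>j\<in>I. a j \<omega> \<bullet> z = 0) \<longrightarrow> z = 0) \<and> finite {z. cubic_map I (\<lambda>j. a j \<omega>) x z = 0}"
proof -
  obtain \<pi> :: "'n \<Rightarrow> 'i" where \<pi>: "inj \<pi>" "range \<pi> \<subseteq> I"
    using inj_on_iff_card_le[of "UNIV :: 'n set" I] fin assms by auto
  have \<pi>I: "\<pi> i \<in> I" for i using \<pi>(2) by blast
  have spanning: "z = 0" if "\<forall>c :: real^'n. (\<Sum>i\<in>UNIV. c $ i *\<^sub>R a (\<pi> i) \<omega>) = 0 \<longrightarrow> c = 0"
    "\<And>j. j \<in> I \<Longrightarrow> a j \<omega> \<bullet> z = 0" for \<omega> z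
    by (rule spanning_if_independent[of "\<lambda>i. a (\<pi> i) \<omega>"]) (use that \<pi>I in auto)
  show ?thesis
  proof (cases "range \<pi> = I")
    \<comment> \<open>The vectors form a basis, so F(z) = 0 forces every coefficient to
      vanish.\<close>
    case True
    show ?thesis
      using AE_independent[OF \<pi>]
    proof eventually_elim
      case (elim \<omega>)
      let ?c = "\<lambda>z j. cubic_coeff (a j \<omega> \<bullet> z) (a j \<omega> \<bullet> x)"
      have "{z. cubic_map I (\<lambda>j. a j \<omega>) x z = 0} \<subseteq> {z. \<forall>j\<in>I. ?c z j = 0}"
      proof
        fix z assume "z \<in> {z. cubic_map I (\<lambda>j. a j \<omega>) x z = 0}"
        then have "(\<Sum>i\<in>UNIV. ?c z (\<pi> i) *\<^sub>R a (\<pi> i) \<omega>) = 0"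
          unfolding cubic_map_def True[symmetric] by (simp add: sum.reindex[OF \<pi>(1)])
        then have "(\<chi> i. ?c z (\<pi> i)) = 0" using elim by simp
        then show "z \<in> {z. \<forall>j\<in>I. ?c z j = 0}" by (auto simp: vec_eq_iff simp flip: True)
      qed
      moreover have "finite {z. \<forall>j\<in>I. ?c z j = 0}"
        using finite_common_zeros_cubic_coeff[OF fin, of "\<lambda>j. a j \<omega>"] spanning[OF elim] by blast
      ultimately show ?case using spanning[OF elim] finite_subset by blast
    qed
  next
    case False
    then obtain j where j: "j \<in> I" "j \<notin> range \<pi>" using \<pi>(2) by blast
    have "AE \<omega> in M. x \<noteq> 0 \<longrightarrow> (\<forall>j\<in>I. a j \<omega> \<bullet> x \<noteq> 0)"
      using AE_inner_nonzero by (cases "x = 0") auto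
    with AE_independent[OF \<pi>] AE_regular[of x] AE_common_zeros[OF \<pi> j, of x] show ?thesis
    proof eventually_elim
      case (elim \<omega>)
      have "finite {z. cubic_map I (\<lambda>j. a j \<omega>) x z = 0}"
        by (rule finite_zeros_cubic_map_generic[OF fin spanning[OF elim(1)]]) (use elim(2-) in blast)+
      then show ?case using spanning[OF elim(1)] by blast
    qed
  qed
qed

end

theorem lemma4p1:
  fixes M :: "'w measure" and x :: "real^'n" and m :: nat
    and a :: "nat \<Rightarrow> 'w \<Rightarrow> real^'n"
  assumes "prob_space M"
    and "prob_space.iid_std_gaussian_entries M m a"
    and "m \<ge> CARD('n)"
  shows "AE \<omega> in M. finite (critical_points (objective m (\<lambda>j. a j \<omega>) x))"
proof -
  interpret prob_space M by fact
  interpret independent_ac_vectors M "{1..m}" a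
    by unfold_locales (use iid_std_gaussian_vectors[OF assms(2)] in auto)
  have "m > 0" using assms(3) zero_less_card_finite[where 'a = 'n] by linarith
  have "AE \<omega> in M. (\<forall>z. (\<forall>j\<in>{1..m}. a j \<omega> \<bullet> z = 0) \<longrightarrow> z = 0) \<and>
      finite {z. cubic_map {1..m} (\<lambda>j. a j \<omega>) x z = 0}"
    using assms(3) by (intro AE_finite_zeros) simp
  then show ?thesis
  proof eventually_elim
    case (elim \<omega>)
    then have "critical_points (objective m (\<lambda>j. a j \<omega>) x) \<subseteq>
        (\<lambda>z. outer z z) ` {z. cubic_map {1..m} (\<lambda>j. a j \<omega>) x z = 0}"
      by (intro critical_points_objective_subset[OF \<open>m > 0\<close>]) auto
    then show ?case using elim by (meson finite_imageI finite_subset)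
  qed
qed

end
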